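(* If an $\omega$-balanced MAP topological group $X$ is $\mathsf{i}{:}\mathsf{TG}$-closed, then its $\omega$-conjucenter $Z^\omega(X)$ is compact.
   Context: All topological groups are assumed Hausdorff. A topological group $X$ is $\omega$-balanced if for any neighborhood $U\subset X$ of the unit there is a countable family $\mathcal V$ of neighborhoods of the unit such that for any $x\in X$ there is $V\in\mathcal V$ with $xVx^{-1}\subset U$. $X$ is MAP (maximally almost periodic) if it admits a continuous injective homomorphism into a compact topological group. $X$ is $\mathsf{i}{:}\mathsf{TG}$-closed if for every injective continuous homomorphism $f:X\to Y$ to a Hausdorff topological group $Y$ the image $f(X)$ is closed in $Y$. A subset $B\subset X$ is $\omega$-narrow if for any neighborhood $U\subset X$ of the unit there is a countable set $C\subset X$ with $B\subset CU\cap UC$. The $\omega$-conjucenter $Z^\omega(X)$ is the set of all $z\in X$ whose conjugacy class $C_X(z)=\{xzx^{-1}:x\in X\}$ is $\omega$-narrow in $X$. *)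

theory Defs
  imports "HOL-Analysis.Analysis" "HOL-Algebra.Coset"
begin

text \<open>Topological groups are Hausdorff throughout.\<close>

locale topological_group = group G for G :: "('a, 'm) monoid_scheme" (structure) +
  fixes T :: "'a topology"
  assumes topspace_eq: "topspace T = carrier G"
    and continuous_mult: "continuous_map (prod_topology T T) T (\<lambda>(x, y). x \<otimes> y)"
    and continuous_inv: "continuous_map T T (\<lambda>x. inv x)"
    and Hausdorff: "Hausdorff_space T"

text \<open>Neighborhoods need not be open.\<close>

definition unit_nbhd :: "('a, 'm) monoid_scheme \<Rightarrow> 'a topology \<Rightarrow> 'a set \<Rightarrow> bool" where
  "unit_nbhd G T U \<longleftrightarrow> U \<subseteq> topspace T \<and> (\<exists>W. openin T W \<and> \<one>\<^bsub>G\<^esub> \<in> W \<and> W \<subseteq> U)"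

definition omega_balanced :: "('a, 'm) monoid_scheme \<Rightarrow> 'a topology \<Rightarrow> bool" where
  "omega_balanced G T \<longleftrightarrow>
    (\<forall>U. unit_nbhd G T U \<longrightarrow>
      (\<exists>\<V>. countable \<V> \<and> (\<forall>V\<in>\<V>. unit_nbhd G T V) \<and>
        (\<forall>x\<in>carrier G. \<exists>V\<in>\<V>. (x <#\<^bsub>G\<^esub> V) #>\<^bsub>G\<^esub> inv\<^bsub>G\<^esub> x \<subseteq> U)))"

definition omega_narrow :: "('a, 'm) monoid_scheme \<Rightarrow> 'a topology \<Rightarrow> 'a set \<Rightarrow> bool" where
  "omega_narrow G T B \<longleftrightarrow> B \<subseteq> carrier G \<and>
    (\<forall>U. unit_nbhd G T U \<longrightarrow>
      (\<exists>C. countable C \<and> C \<subseteq> carrier G \<and> B \<subseteq> (C <#>\<^bsub>G\<^esub> U) \<inter> (U <#>\<^bsub>G\<^esub> C)))"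

definition conjugacy_class :: "('a, 'm) monoid_scheme \<Rightarrow> 'a \<Rightarrow> 'a set" where
  "conjugacy_class G z = {x \<otimes>\<^bsub>G\<^esub> z \<otimes>\<^bsub>G\<^esub> inv\<^bsub>G\<^esub> x | x. x \<in> carrier G}"

definition omega_conjucenter :: "('a, 'm) monoid_scheme \<Rightarrow> 'a topology \<Rightarrow> 'a set" where
  "omega_conjucenter G T = {z \<in> carrier G. omega_narrow G T (conjugacy_class G z)}"

definition inj_cont_hom ::
  "('a, 'm) monoid_scheme \<Rightarrow> 'a topology \<Rightarrow> ('b, 'n) monoid_scheme \<Rightarrow> 'b topology \<Rightarrow> ('a \<Rightarrow> 'b) \<Rightarrow> bool"
where
  "inj_cont_hom G T H S f \<longleftrightarrow>
    f \<in> hom G H \<and> inj_on f (carrier G) \<and> continuous_map T S f"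

text \<open>
  The target groups of the next two notions range over all topological groups; HOL cannot quantify
  over types inside a formula, so the type of the elements of the target group is a parameter.
\<close>

definition MAP_group :: "'k itself \<Rightarrow> ('a, 'm) monoid_scheme \<Rightarrow> 'a topology \<Rightarrow> bool" where
  "MAP_group _ G T \<longleftrightarrow>
    (\<exists>(K :: 'k monoid) S f. topological_group K S \<and> compact_space S \<and> inj_cont_hom G T K S f)"

definition iTG_closed :: "'y itself \<Rightarrow> ('a, 'm) monoid_scheme \<Rightarrow> 'a topology \<Rightarrow> bool" where
  "iTG_closed _ G T \<longleftrightarrow>
    (\<forall>(Y :: 'y monoid) S f. topological_group Y S \<longrightarrow> inj_cont_hom G T Y S f \<longrightarrow>
      closedin S (f ` carrier G))"

text \<open>
  The instance \<open>'y = 'a set set\<close> of \<open>iTG_closed\<close> covers targets of every type: in a Hausdorff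
  space the points \<open>y\<close> of the closure of \<open>f ` carrier G\<close> are determined by the family of all
  \<open>A \<subseteq> carrier G\<close> with \<open>y\<close> in the closure of \<open>f ` A\<close>.
\<close>

context topological_group
begin

lemma closure_mult:
  assumes D: "D \<subseteq> carrier G" "\<And>x y. x \<in> D \<Longrightarrow> y \<in> D \<Longrightarrow> x \<otimes> y \<in> D"
    and "x \<in> T closure_of D" "y \<in> T closure_of D"
  shows "x \<otimes> y \<in> T closure_of D"
proof -
  have "(\<lambda>(x, y). x \<otimes> y) ` (prod_topology T T closure_of (D \<times> D))
      \<subseteq> T closure_of ((\<lambda>(x, y). x \<otimes> y) ` (D \<times> D))"
    by (rule continuous_map_image_closure_subset[OF continuous_mult])
  moreover have "T closure_of ((\<lambda>(x, y). x \<otimes> y) ` (D \<times> D)) \<subseteq> T closure_of D"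
    by (rule closure_of_mono) (use D in auto)
  ultimately show ?thesis
    using assms by (force simp: closure_of_Times)
qed

lemma closure_inv:
  assumes D: "D \<subseteq> carrier G" "\<And>x. x \<in> D \<Longrightarrow> inv x \<in> D"
    and "x \<in> T closure_of D"
  shows "inv x \<in> T closure_of D"
proof -
  have "(\<lambda>x. inv x) ` (T closure_of D) \<subseteq> T closure_of ((\<lambda>x. inv x) ` D)"
    by (rule continuous_map_image_closure_subset[OF continuous_inv])
  moreover have "T closure_of ((\<lambda>x. inv x) ` D) \<subseteq> T closure_of D"
    by (rule closure_of_mono) (use D in auto)
  ultimately show ?thesis
    using assms by blast
qed

end

lemma inj_on_closure_trace:
  assumes "Hausdorff_space S" "f ` X \<subseteq> topspace S"
  shows "inj_on (\<lambda>y. {A. A \<subseteq> X \<and> y \<in> S closure_of (f ` A)}) (S closure_of (f ` X))"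
proof (rule inj_onI, rule ccontr)
  fix y z
  assume y: "y \<in> S closure_of (f ` X)" and z: "z \<in> S closure_of (f ` X)" and "y \<noteq> z"
    and eq: "{A. A \<subseteq> X \<and> y \<in> S closure_of (f ` A)} = {A. A \<subseteq> X \<and> z \<in> S closure_of (f ` A)}"
  obtain U V where UV: "openin S U" "openin S V" "y \<in> U" "z \<in> V" "disjnt U V"
    using assms(1) y z \<open>y \<noteq> z\<close> unfolding Hausdorff_space_def by (meson in_closure_of)
  define A where "A = {x \<in> X. f x \<in> U}"
  have "y \<in> S closure_of (f ` A)"
    unfolding in_closure_of
  proof (intro conjI allI impI)
    show "y \<in> topspace S" using y by (simp add: in_closure_of)
    fix W assume "y \<in> W \<and> openin S W"
    then have "y \<in> W \<inter> U" "openin S (W \<inter> U)" using UV by auto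
    then obtain p where "p \<in> f ` X" "p \<in> W \<inter> U" using y unfolding in_closure_of by blast
    then show "\<exists>p. p \<in> f ` A \<and> p \<in> W" by (auto simp: A_def)
  qed
  then have "z \<in> S closure_of (f ` A)" using eq by (auto simp: A_def)
  then obtain p where "p \<in> f ` A" "p \<in> V" using UV unfolding in_closure_of by blast
  then show False using UV by (auto simp: A_def disjnt_iff)
qed

proposition iTG_closed_all_types:
  fixes G :: "('a, 'm) monoid_scheme"
  assumes G: "topological_group G T" and closed: "iTG_closed TYPE('a set set) G T"
  shows "iTG_closed TYPE('y) G T"
  unfolding iTG_closed_def
proof (intro allI impI)
  fix Y :: "'y monoid" and S f
  assume Y: "topological_group Y S" and f: "inj_cont_hom G T Y S f"
  interpret G: topological_group G T by fact
  interpret Y: topological_group Y S by fact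
  interpret h: group_hom G Y f
    by unfold_locales (use f in \<open>simp add: inj_cont_hom_def\<close>)
  define D where "D = f ` carrier G"
  define C where "C = S closure_of D"
  define e where "e y = {A. A \<subseteq> carrier G \<and> y \<in> S closure_of (f ` A)}" for y
  define d where "d = inv_into C e"
  define R where "R = pullback_topology (e ` C) d (subtopology S C)"
  define K where "K = \<lparr>carrier = e ` C, mult = (\<lambda>a b. e (d a \<otimes>\<^bsub>Y\<^esub> d b)), one = e \<one>\<^bsub>Y\<^esub>\<rparr>"
  have DY: "D \<subseteq> carrier Y" by (auto simp: D_def)
  have DC: "D \<subseteq> C" unfolding C_def using DY by (simp add: closure_of_subset Y.topspace_eq)
  have CY: "C \<subseteq> carrier Y" unfolding C_def using closure_of_subset_topspace[of S D] by (simp add: Y.topspace_eq)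
  have inj: "inj_on e C"
    unfolding C_def D_def e_def
    by (rule inj_on_closure_trace) (use Y.Hausdorff DY in \<open>auto simp: D_def Y.topspace_eq\<close>)
  have de [simp]: "d (e c) = c" if "c \<in> C" for c using that inj by (simp add: d_def)
  have one_C: "\<one>\<^bsub>Y\<^esub> \<in> C" using DC by (metis D_def G.one_closed h.hom_one imageI subsetD)
  have mult_C: "x \<otimes>\<^bsub>Y\<^esub> y \<in> C" if "x \<in> C" "y \<in> C" for x y
    using that unfolding C_def
    by (intro Y.closure_mult) (auto simp: D_def simp flip: h.hom_mult)
  have inv_C: "inv\<^bsub>Y\<^esub> x \<in> C" if "x \<in> C" for x
    using that unfolding C_def
    by (intro Y.closure_inv) (auto simp: D_def simp flip: h.hom_inv)
  have K: "group K"
  proof (rule groupI)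
    fix x assume "x \<in> carrier K"
    then obtain c where c: "c \<in> C" "x = e c" by (auto simp: K_def)
    then show "\<exists>y\<in>carrier K. y \<otimes>\<^bsub>K\<^esub> x = \<one>\<^bsub>K\<^esub>"
      using CY inv_C by (intro bexI[of _ "e (inv\<^bsub>Y\<^esub> c)"]) (auto simp: K_def)
  qed (use one_C mult_C CY in \<open>auto simp: K_def Y.m_assoc subset_eq\<close>)
  have invK: "inv\<^bsub>K\<^esub> (e c) = e (inv\<^bsub>Y\<^esub> c)" if "c \<in> C" for c
    by (rule group.inv_equality[OF K]) (use that inv_C CY in \<open>auto simp: K_def subset_eq\<close>)
  have top_R: "topspace R = e ` C"
    using CY by (auto simp: R_def topspace_pullback_topology Y.topspace_eq)
  have top_C: "topspace (subtopology S C) = C" using CY by (auto simp: Y.topspace_eq)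
  have cont_d: "continuous_map R (subtopology S C) d"
    unfolding R_def using continuous_map_pullback[OF continuous_map_id] by (metis id_comp)
  have cont_e: "continuous_map (subtopology S C) R e"
    unfolding R_def
  proof (rule continuous_map_pullback')
    have "continuous_map (subtopology S C) (subtopology S C) id" by simp
    then show "continuous_map (subtopology S C) (subtopology S C) (d \<circ> e)"
      by (rule continuous_map_eq) (use top_C in auto)
  qed (use top_C in auto)
  have home: "homeomorphic_maps (subtopology S C) R e d"
    unfolding homeomorphic_maps_def using cont_d cont_e top_R top_C by auto
  have dS: "continuous_map R S d" using cont_d by (simp add: continuous_map_in_subtopology)
  have "topological_group K R"
  proof (intro topological_group.intro K topological_group_axioms.intro)
    show "topspace R = carrier K" by (simp add: top_R K_def)
    show "Hausdorff_space R"
      using homeomorphic_Hausdorff_space[of "subtopology S C" R] home Y.Hausdorff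
      by (meson Hausdorff_space_subtopology homeomorphic_space_def)
    have "continuous_map (prod_topology R R) (prod_topology S S) (\<lambda>(a, b). (d a, d b))"
      using dS by (simp add: continuous_map_prod_top)
    from continuous_map_compose[OF this Y.continuous_mult]
    have "continuous_map (prod_topology R R) S (\<lambda>p. d (fst p) \<otimes>\<^bsub>Y\<^esub> d (snd p))"
      by (simp add: o_def case_prod_unfold)
    then have "continuous_map (prod_topology R R) (subtopology S C) (\<lambda>p. d (fst p) \<otimes>\<^bsub>Y\<^esub> d (snd p))"
      by (auto simp: continuous_map_in_subtopology top_R mult_C)
    from continuous_map_compose[OF this cont_e]
    show "continuous_map (prod_topology R R) R (\<lambda>(x, y). x \<otimes>\<^bsub>K\<^esub> y)"
      by (simp add: o_def case_prod_unfold K_def)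
    from continuous_map_compose[OF dS Y.continuous_inv]
    have "continuous_map R (subtopology S C) (\<lambda>x. inv\<^bsub>Y\<^esub> (d x))"
      by (auto simp: continuous_map_in_subtopology top_R inv_C o_def)
    from continuous_map_compose[OF this cont_e]
    show "continuous_map R R (\<lambda>x. inv\<^bsub>K\<^esub> x)"
      by (rule continuous_map_eq) (auto simp: top_R invK)
  qed
  moreover have "inj_cont_hom G T K R (e \<circ> f)"
    unfolding inj_cont_hom_def
  proof (intro conjI)
    have fC: "f x \<in> C" if "x \<in> carrier G" for x using that DC by (auto simp: D_def)
    show "e \<circ> f \<in> hom G K" using fC by (auto simp: hom_def K_def)
    show "inj_on (e \<circ> f) (carrier G)"
      using f inj fC by (auto simp: inj_cont_hom_def intro!: comp_inj_on inj_on_subset[OF inj])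
    have "continuous_map T (subtopology S C) f"
      using f fC by (auto simp: inj_cont_hom_def continuous_map_in_subtopology G.topspace_eq)
    then show "continuous_map T R (e \<circ> f)" using cont_e by (rule continuous_map_compose)
  qed
  ultimately have "closedin R ((e \<circ> f) ` carrier G)"
    using closed unfolding iTG_closed_def by blast
  then have "closedin R (e ` D)" by (simp add: D_def image_comp)
  then have "closedin (subtopology S C) D"
    using homeomorphic_map_closedness_eq[of "subtopology S C" R e D] home DC top_C
    by (metis homeomorphic_map_maps)
  then show "closedin S (f ` carrier G)"
    unfolding D_def[symmetric]
    by (rule closedin_trans_full) (simp add: C_def)
qed

end

theory Submission
  imports Defs "HOL-Algebra.Generated_Groups"
begin

text \<open>Write \<open>Z\<close> for the \<open>\<omega>\<close>-conjucenter of the group \<open>(G,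
T)\<close>. Since \<open>G\<close> is MAP and \<open>i:TG\<close>-closed, its image in some compact group is
closed, hence compact; pulled back to \<open>G\<close>, this gives a compact Hausdorff group topology
\<open>K\<close> coarser than \<open>T\<close> (\<open>iTG_closed_MAP_over_compact\<close>). The heart of the
proof is that every \<open>T\<close>-closed normal \<open>\<omega>\<close>-narrow subgroup \<open>H\<close> is
\<open>T\<close>-compact (\<open>compactin_narrow\<close>); this is an open mapping theorem for the identity
\<open>(H, T) \<rightarrow> (H, K)\<close>, and it combines three ingredients.

\<^item> \<open>H\<close> is \<open>K\<close>-closed. The diagonal map embeds \<open>G\<close> into \<open>(G,
  K) \<times> (G, T) / H\<close>, its image is closed there, and the \<open>K\<close>-closure of
  \<open>H\<close> shows up in the closure of this image (\<open>normal_closedin_coarse\<close>).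

\<^item> The identity is almost open. As \<open>H\<close> is covered by countably many translates of a small
  set, the Baire category theorem in the compact space \<open>(H, K)\<close> shows that the
  \<open>K\<close>-closure of \<open>V \<inter> H\<close> is a \<open>K\<close>-neighborhood of the unit in
  \<open>H\<close> for each \<open>T\<close>-neighborhood \<open>V\<close> of the unit
  (\<open>closure_contains_coarse_nbhd\<close>).

\<^item> A form of completeness. As \<open>G\<close> is \<open>\<omega>\<close>-balanced, each
  \<open>T\<close>-neighborhood of the unit contains the first member of a sequence \<open>U\<close> of
  neighborhoods that is a base of a group topology, in general not Hausdorff. The two-sided Cauchy sequences
  for \<open>U\<close> form a group \<open>C\<close>, in which \<open>G\<close> sits as the group of constant
  sequences. Closedness of \<open>G\<close> in the Hausdorff quotient of \<open>(G, K) \<times> C\<close> says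
  that a \<open>U\<close>-Cauchy sequence converges in \<open>U\<close> to every point to which it is close
  for \<open>K\<close> and \<open>U\<close> simultaneously (\<open>cauchy_converges\<close>).

The usual successive approximation that removes the closure from almost openness only yields one-sided Cauchy
sequences. Two-sided ones are available at the points outside a meagre set: there, a point in the
\<open>K\<close>-closure of a basic \<open>U\<close>-open set is also in the \<open>K\<close>-closure of an
arbitrarily small one inside it (\<open>not_bad_refine\<close>), and hence is a \<open>U\<close>-limit of
points of these sets (\<open>not_bad_in_U\<close>). As in Pettis' theorem, every \<open>w\<close> close to the
unit in \<open>(H, K)\<close> is a quotient of two such points, so \<open>w\<close> is close to the unit for
\<open>T\<close> (\<open>coarse_nbhd_in_quotients\<close>). So \<open>K\<close> and \<open>T\<close> agree on
\<open>H\<close>.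

To pass from such subgroups to \<open>Z\<close>: a countable subset of \<open>Z\<close> lies in the closed
normal subgroup generated by countably many \<open>\<omega>\<close>-narrow conjugacy classes; this subgroup is
\<open>\<omega>\<close>-narrow, so compact. Hence \<open>Z\<close> contains no infinite uniformly discrete
sequence, so it is precompact, and a fortiori \<open>\<omega>\<close>-narrow. Then the closed normal subgroup
generated by \<open>Z\<close> is again \<open>\<omega>\<close>-narrow, hence compact; all its conjugacy
classes are \<open>\<omega>\<close>-narrow, so it is contained in \<open>Z\<close> and equals
\<open>Z\<close>.\<close>

section \<open>Hausdorff groups from neighborhood bases of the unit\<close>

context group
begin

lemma inv_mult_cancel [simp]:
  assumes "x \<in> carrier G" "y \<in> carrier G"
  shows "inv x \<otimes> (x \<otimes> y) = y" "x \<otimes> (inv x \<otimes> y) = y"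
  using assms by (simp_all flip: m_assoc)

lemmas word_simps = m_assoc inv_mult_group

end

text \<open>The neighborhood base at the unit of a group topology in which points need not be separated. All
groups into which the proof maps \<open>G\<close> are given in this form.\<close>

locale unit_filter_base = group G for G :: "('a, 'm) monoid_scheme" (structure) +
  fixes \<B> :: "'a set set"
  assumes nonempty: "\<B> \<noteq> {}"
    and base_subset: "B \<in> \<B> \<Longrightarrow> B \<subseteq> carrier G"
    and base_one: "B \<in> \<B> \<Longrightarrow> \<one> \<in> B"
    and base_directed: "B \<in> \<B> \<Longrightarrow> B' \<in> \<B> \<Longrightarrow> \<exists>C\<in>\<B>. C \<subseteq> B \<inter> B'"
    and base_mult: "B \<in> \<B> \<Longrightarrow> \<exists>C\<in>\<B>. \<forall>x\<in>C. \<forall>y\<in>C. x \<otimes> y \<in> B"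
    and base_inv: "B \<in> \<B> \<Longrightarrow> \<exists>C\<in>\<B>. \<forall>x\<in>C. inv x \<in> B"
    and base_conj: "B \<in> \<B> \<Longrightarrow> g \<in> carrier G \<Longrightarrow> \<exists>C\<in>\<B>. \<forall>x\<in>C. g \<otimes> x \<otimes> inv g \<in> B"
begin

text \<open>The closure of the unit; dividing by it makes the group Hausdorff.\<close>

definition core :: "'a set" where "core = \<Inter>\<B>"

abbreviation proj :: "'a \<Rightarrow> 'a set" where "proj g \<equiv> core #> g"

lemma core_subset: "core \<subseteq> carrier G"
  using nonempty base_subset by (auto simp: core_def)

lemma core_normal: "core \<lhd> G"
proof (rule normal_invI)
  show "subgroup core G"
  proof (rule subgroupI[OF core_subset])
    show "core \<noteq> {}" using base_one by (auto simp: core_def)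
    show "inv a \<in> core" if "a \<in> core" for a
      using that base_inv unfolding core_def by (meson Inter_iff)
    show "a \<otimes> b \<in> core" if "a \<in> core" "b \<in> core" for a b
      using that base_mult unfolding core_def by (meson Inter_iff)
  qed
  show "g \<otimes> h \<otimes> inv g \<in> core" if "g \<in> carrier G" "h \<in> core" for g h
    using that base_conj unfolding core_def by (meson Inter_iff)
qed

sublocale core: normal core G by (rule core_normal)

lemma proj_mult: "g \<in> carrier G \<Longrightarrow> h \<in> carrier G \<Longrightarrow> proj g <#> proj h = proj (g \<otimes> h)"
  by (rule core.rcos_sum)

lemma proj_eq_iff:
  assumes "g \<in> carrier G" "h \<in> carrier G"
  shows "proj g = proj h \<longleftrightarrow> inv g \<otimes> h \<in> core"
proof
  assume "proj g = proj h"
  then have "h \<in> proj g" using assms rcos_self core.subgroup_axioms by simp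
  then obtain n where n: "n \<in> core" "h = n \<otimes> g" by (auto simp: r_coset_def)
  then show "inv g \<otimes> h \<in> core"
    using core.inv_op_closed1[OF assms(1) n(1)] core_subset assms by (simp add: word_simps subset_eq)
next
  assume "inv g \<otimes> h \<in> core"
  then have "g \<otimes> (inv g \<otimes> h) \<otimes> inv g \<in> core" using assms core.inv_op_closed2 by blast
  then have "h \<otimes> inv g \<in> core" using assms by (simp add: word_simps)
  then have "(h \<otimes> inv g) \<otimes> g \<in> proj g" by (auto simp: r_coset_def)
  then have "h \<in> proj g" using assms by (simp add: word_simps)
  then show "proj g = proj h" using assms repr_independence core.subgroup_axioms by blast
qed

lemma carrier_Mod: "carrier (G Mod core) = proj ` carrier G"
  by (auto simp: FactGroup_def RCOSETS_def)

lemma mult_Mod: "g \<in> carrier G \<Longrightarrow> h \<in> carrier G \<Longrightarrow>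
   proj g \<otimes>\<^bsub>G Mod core\<^esub> proj h = proj (g \<otimes> h)"
  by (simp add: FactGroup_def proj_mult)

lemma inv_Mod: "g \<in> carrier G \<Longrightarrow> inv\<^bsub>G Mod core\<^esub> (proj g) = proj (inv g)"
  by (rule group.inv_equality[OF core.factorgroup_is_group])
     (simp_all add: FactGroup_def proj_mult core_subset rcosetsI)

definition quotient_topology :: "'a set topology" where
  "quotient_topology = topology (\<lambda>U. U \<subseteq> proj ` carrier G \<and>
     (\<forall>g\<in>carrier G. proj g \<in> U \<longrightarrow> (\<exists>B\<in>\<B>. \<forall>b\<in>B. proj (g \<otimes> b) \<in> U)))"

lemma openin_quotient:
  "openin quotient_topology U \<longleftrightarrow> U \<subseteq> proj ` carrier G \<and>
     (\<forall>g\<in>carrier G. proj g \<in> U \<longrightarrow> (\<exists>B\<in>\<B>. \<forall>b\<in>B. proj (g \<otimes> b) \<in> U))"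
proof -
  define P where "P U \<longleftrightarrow> U \<subseteq> proj ` carrier G \<and>
     (\<forall>g\<in>carrier G. proj g \<in> U \<longrightarrow> (\<exists>B\<in>\<B>. \<forall>b\<in>B. proj (g \<otimes> b) \<in> U))" for U
  have "istopology P"
    unfolding istopology_def
  proof (intro conjI allI impI)
    fix S T assume S: "P S" and T: "P T"
    have "\<exists>B\<in>\<B>. \<forall>b\<in>B. proj (g \<otimes> b) \<in> S \<inter> T" if g: "g \<in> carrier G" "proj g \<in> S \<inter> T" for g
    proof -
      have "\<exists>B\<in>\<B>. \<forall>b\<in>B. proj (g \<otimes> b) \<in> S" "\<exists>B\<in>\<B>. \<forall>b\<in>B. proj (g \<otimes> b) \<in> T"
        using S T g by (simp_all add: P_def)
      then obtain B B' where B: "B \<in> \<B>" "\<forall>b\<in>B. proj (g \<otimes> b) \<in> S"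
        and B': "B' \<in> \<B>" "\<forall>b\<in>B'. proj (g \<otimes> b) \<in> T"
        by (elim bexE) rule
      obtain C where "C \<in> \<B>" "C \<subseteq> B \<inter> B'" using base_directed[OF B(1) B'(1)] ..
      then show ?thesis using B(2) B'(2) by (intro bexI[of _ C]) auto
    qed
    moreover have "S \<inter> T \<subseteq> proj ` carrier G" using S by (auto simp: P_def)
    ultimately show "P (S \<inter> T)" unfolding P_def by simp
  next
    fix \<K> assume \<K>: "\<forall>K\<in>\<K>. P K"
    have "\<exists>B\<in>\<B>. \<forall>b\<in>B. proj (g \<otimes> b) \<in> \<Union>\<K>" if g: "g \<in> carrier G" "proj g \<in> \<Union>\<K>" for g
    proof -
      obtain K where K: "K \<in> \<K>" "proj g \<in> K" using g by (elim UnionE)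
      then have "\<exists>B\<in>\<B>. \<forall>b\<in>B. proj (g \<otimes> b) \<in> K" using \<K> g(1) by (simp add: P_def)
      then show ?thesis using K(1) by (meson UnionI)
    qed
    moreover have "\<Union>\<K> \<subseteq> proj ` carrier G"
      by (rule Union_least) (use \<K> P_def in metis)
    ultimately show "P (\<Union>\<K>)" unfolding P_def by simp
  qed
  moreover have "quotient_topology = topology P" unfolding quotient_topology_def P_def ..
  ultimately show ?thesis unfolding P_def by simp
qed

lemma topspace_quotient: "topspace quotient_topology = proj ` carrier G"
proof (rule antisym)
  show "topspace quotient_topology \<subseteq> proj ` carrier G"
    using openin_quotient openin_topspace by blast
  have "openin quotient_topology (proj ` carrier G)"
    unfolding openin_quotient using nonempty base_subset by blast
  then show "proj ` carrier G \<subseteq> topspace quotient_topology" by (rule openin_subset)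
qed

text \<open>The images of the sets \<open>g B\<close> are neighborhoods of the class of \<open>g\<close>. The
open set is the interior of this image, and it is well defined because the classes multiply: whether \<open>h
C\<close> is mapped into the image depends only on the class of \<open>h\<close>.\<close>

lemma quotient_nbhd:
  assumes g: "g \<in> carrier G" and B: "B \<in> \<B>"
  obtains U where "openin quotient_topology U" "proj g \<in> U" "U \<subseteq> (\<lambda>b. proj (g \<otimes> b)) ` B"
proof
  define A where "A = (\<lambda>b. proj (g \<otimes> b)) ` B"
  define U where "U = {proj h | h. h \<in> carrier G \<and> (\<exists>C\<in>\<B>. \<forall>c\<in>C. proj (h \<otimes> c) \<in> A)}"
  show "openin quotient_topology U"
    unfolding openin_quotient
  proof (intro conjI ballI impI)
    show "U \<subseteq> proj ` carrier G" by (auto simp: U_def)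
    fix h assume h: "h \<in> carrier G" "proj h \<in> U"
    then obtain h' C where C: "h' \<in> carrier G" "proj h = proj h'" "C \<in> \<B>" "\<forall>c\<in>C. proj (h' \<otimes> c) \<in> A"
      by (auto simp: U_def)
    have *: "proj (h \<otimes> c) \<in> A" if "c \<in> C" for c
      using that C h base_subset proj_mult by (metis subsetD)
    obtain D where D: "D \<in> \<B>" "\<forall>x\<in>D. \<forall>y\<in>D. x \<otimes> y \<in> C" using base_mult C by blast
    have "proj (h \<otimes> d) \<in> U" if d: "d \<in> D" for d
      unfolding U_def
    proof (intro CollectI exI conjI bexI ballI)
      show dG: "h \<otimes> d \<in> carrier G" using d h D base_subset by blast
      fix c assume c: "c \<in> D"
      show "proj (h \<otimes> d \<otimes> c) \<in> A" using *[of "d \<otimes> c"] d c D(2) h base_subset[OF D(1)] by (simp add: m_assoc subset_eq)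
    qed (use D in auto)
    then show "\<exists>B\<in>\<B>. \<forall>b\<in>B. proj (h \<otimes> b) \<in> U" using D by blast
  qed
  show "proj g \<in> U" using g B by (auto simp: U_def A_def)
  show "U \<subseteq> (\<lambda>b. proj (g \<otimes> b)) ` B"
  proof
    fix u assume "u \<in> U"
    then obtain h C where "u = proj h" "h \<in> carrier G" "C \<in> \<B>" "\<forall>c\<in>C. proj (h \<otimes> c) \<in> A" by (auto simp: U_def)
    then show "u \<in> (\<lambda>b. proj (g \<otimes> b)) ` B" using base_one unfolding A_def by (metis r_one)
  qed
qed

theorem quotient_topological_group: "topological_group (G Mod core) quotient_topology"
proof (intro topological_group.intro topological_group_axioms.intro)
  show "group (G Mod core)" by (rule core.factorgroup_is_group)
  show "topspace quotient_topology = carrier (G Mod core)" by (simp add: topspace_quotient carrier_Mod)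
  show "Hausdorff_space quotient_topology"
    unfolding Hausdorff_space_def
  proof (intro allI impI)
    fix x y assume xy: "x \<in> topspace quotient_topology \<and> y \<in> topspace quotient_topology \<and> x \<noteq> y"
    then obtain g h where gh: "g \<in> carrier G" "h \<in> carrier G" "x = proj g" "y = proj h"
      by (auto simp: topspace_quotient)
    with xy have "inv g \<otimes> h \<notin> core" using proj_eq_iff by blast
    then obtain B where B: "B \<in> \<B>" "inv g \<otimes> h \<notin> B" by (auto simp: core_def)
    obtain C where C: "C \<in> \<B>" "\<forall>x\<in>C. \<forall>y\<in>C. x \<otimes> y \<in> B" using base_mult B by blast
    obtain D where D: "D \<in> \<B>" "\<forall>x\<in>D. \<forall>y\<in>D. x \<otimes> y \<in> C" using base_mult C by blast
    obtain E where E: "E \<in> \<B>" "\<forall>x\<in>E. inv x \<in> C" using base_inv C by blast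
    \<comment> \<open>Classes of \<open>g a\<close> and \<open>h b\<close> can only agree if \<open>inv g \<otimes> h\<close> is a product \<open>a (core) inv b\<close>, so three
      factors have to fit into \<open>B\<close>.\<close>
    obtain F where F: "F \<in> \<B>" "F \<subseteq> D \<inter> E" using base_directed D E by blast
    obtain U where U: "openin quotient_topology U" "proj g \<in> U" "U \<subseteq> (\<lambda>b. proj (g \<otimes> b)) ` F"
      using quotient_nbhd gh F by metis
    obtain V where V: "openin quotient_topology V" "proj h \<in> V" "V \<subseteq> (\<lambda>b. proj (h \<otimes> b)) ` F"
      using quotient_nbhd gh F by metis
    have "disjnt U V"
    proof (rule ccontr)
      assume "\<not> disjnt U V"
      then obtain a b where ab: "a \<in> F" "b \<in> F" "proj (g \<otimes> a) = proj (h \<otimes> b)"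
        using U V unfolding disjnt_iff by blast
      have car: "a \<in> carrier G" "b \<in> carrier G" using ab F base_subset by blast+
      then have "inv (g \<otimes> a) \<otimes> (h \<otimes> b) \<in> core" using ab gh by (simp add: proj_eq_iff)
      then have "inv (g \<otimes> a) \<otimes> (h \<otimes> b) \<in> D" using D by (auto simp: core_def)
      then have "a \<otimes> (inv (g \<otimes> a) \<otimes> (h \<otimes> b)) \<in> C" using D ab F by blast
      then have "a \<otimes> (inv (g \<otimes> a) \<otimes> (h \<otimes> b)) \<otimes> inv b \<in> B" using C E ab F by blast
      moreover have "a \<otimes> (inv (g \<otimes> a) \<otimes> (h \<otimes> b)) \<otimes> inv b = inv g \<otimes> h"
        using car gh by (simp add: word_simps)
      ultimately show False using B by simp
    qed
    then show "\<exists>U V. openin quotient_topology U \<and> openin quotient_topology V \<and> x \<in> U \<and> y \<in> V \<and> disjnt U V"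
      using U V gh by blast
  qed
  show "continuous_map quotient_topology quotient_topology (\<lambda>x. inv\<^bsub>G Mod core\<^esub> x)"
    unfolding continuous_map_def topspace_quotient
  proof (intro conjI allI impI)
    show "(\<lambda>x. inv\<^bsub>G Mod core\<^esub> x) \<in> proj ` carrier G \<rightarrow> proj ` carrier G" by (auto simp: inv_Mod)
    fix U assume U: "openin quotient_topology U"
    show "openin quotient_topology {x \<in> proj ` carrier G. inv\<^bsub>G Mod core\<^esub> x \<in> U}"
      unfolding openin_quotient
    proof (intro conjI ballI impI)
      fix g assume g: "g \<in> carrier G" "proj g \<in> {x \<in> proj ` carrier G. inv\<^bsub>G Mod core\<^esub> x \<in> U}"
      then have "proj (inv g) \<in> U" by (auto simp: inv_Mod)
      then obtain B where B: "B \<in> \<B>" "\<forall>b\<in>B. proj (inv g \<otimes> b) \<in> U"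
        using U g unfolding openin_quotient by (meson inv_closed)
      obtain C where C: "C \<in> \<B>" "\<forall>x\<in>C. g \<otimes> x \<otimes> inv g \<in> B" using base_conj B g by blast
      obtain D where D: "D \<in> \<B>" "\<forall>x\<in>D. inv x \<in> C" using base_inv C by blast
      have "proj (g \<otimes> d) \<in> {x \<in> proj ` carrier G. inv\<^bsub>G Mod core\<^esub> x \<in> U}" if d: "d \<in> D" for d
      proof -
        have dG: "d \<in> carrier G" using d D base_subset by blast
        have "proj (inv g \<otimes> (g \<otimes> inv d \<otimes> inv g)) \<in> U" using d D C B by blast
        then have "proj (inv (g \<otimes> d)) \<in> U" using dG g by (simp add: word_simps)
        then show ?thesis using dG g by (simp add: inv_Mod)
      qed
      then show "\<exists>B\<in>\<B>. \<forall>b\<in>B. proj (g \<otimes> b) \<in> {x \<in> proj ` carrier G. inv\<^bsub>G Mod core\<^esub> x \<in> U}"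
        using D by blast
    qed auto
  qed
  show "continuous_map (prod_topology quotient_topology quotient_topology) quotient_topology
     (\<lambda>(x, y). x \<otimes>\<^bsub>G Mod core\<^esub> y)"
    unfolding continuous_map_def topspace_prod_topology topspace_quotient
  proof (intro conjI allI impI)
    show "(\<lambda>(x, y). x \<otimes>\<^bsub>G Mod core\<^esub> y) \<in> proj ` carrier G \<times> proj ` carrier G \<rightarrow> proj ` carrier G"
      by (auto simp: mult_Mod proj_mult)
    fix U assume U: "openin quotient_topology U"
    let ?P = "{x \<in> proj ` carrier G \<times> proj ` carrier G. (case x of (x, y) \<Rightarrow> x \<otimes>\<^bsub>G Mod core\<^esub> y) \<in> U}"
    show "openin (prod_topology quotient_topology quotient_topology) ?P"
      unfolding openin_prod_topology_alt
    proof (intro allI impI)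
      fix x y assume "(x, y) \<in> ?P"
      then obtain g h where gh: "g \<in> carrier G" "h \<in> carrier G" "x = proj g" "y = proj h"
        and "proj g \<otimes>\<^bsub>G Mod core\<^esub> proj h \<in> U" by auto
      then have "proj (g \<otimes> h) \<in> U" by (simp only: mult_Mod)
      then obtain B where B: "B \<in> \<B>" "\<forall>b\<in>B. proj (g \<otimes> h \<otimes> b) \<in> U"
        using U gh(1,2) unfolding openin_quotient by (meson m_closed)
      obtain C where C: "C \<in> \<B>" "\<forall>x\<in>C. \<forall>y\<in>C. x \<otimes> y \<in> B" using base_mult B by blast
      obtain D where D: "D \<in> \<B>" "\<forall>x\<in>D. inv h \<otimes> x \<otimes> inv (inv h) \<in> C" using base_conj C gh by blast
      obtain V where V: "openin quotient_topology V" "proj g \<in> V" "V \<subseteq> (\<lambda>b. proj (g \<otimes> b)) ` D"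
        using quotient_nbhd gh D by metis
      obtain W where W: "openin quotient_topology W" "proj h \<in> W" "W \<subseteq> (\<lambda>b. proj (h \<otimes> b)) ` C"
        using quotient_nbhd gh C by metis
      have "V \<times> W \<subseteq> ?P"
      proof
        fix p assume "p \<in> V \<times> W"
        then obtain a b where ab: "a \<in> D" "b \<in> C" "p = (proj (g \<otimes> a), proj (h \<otimes> b))"
          using V W by blast
        have car: "a \<in> carrier G" "b \<in> carrier G" using ab C D base_subset by blast+
        have "proj (g \<otimes> h \<otimes> (inv h \<otimes> a \<otimes> inv (inv h) \<otimes> b)) \<in> U" using B C D ab by blast
        then have "proj ((g \<otimes> a) \<otimes> (h \<otimes> b)) \<in> U" using car gh by (simp add: word_simps)
        then show "p \<in> ?P" using ab car gh by (simp del: mult_FactGroup add: mult_Mod)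
      qed
      then show "\<exists>V W. openin quotient_topology V \<and> openin quotient_topology W \<and> x \<in> V \<and> y \<in> W \<and> V \<times> W \<subseteq> ?P"
        using V W gh by blast
    qed
  qed
qed

end

section \<open>Neighborhoods of the unit in a topological group\<close>

lemma unit_filter_base_DirProd:
  assumes "unit_filter_base G \<A>" "unit_filter_base H \<B>"
  shows "unit_filter_base (G \<times>\<times> H) {A \<times> B | A B. A \<in> \<A> \<and> B \<in> \<B>}"
proof -
  interpret G: unit_filter_base G \<A> by fact
  interpret H: unit_filter_base H \<B> by fact
  show ?thesis
  proof (intro unit_filter_base.intro unit_filter_base_axioms.intro)
    show "Group.group (G \<times>\<times> H)" by (rule DirProd_group) auto
    show "{A \<times> B | A B. A \<in> \<A> \<and> B \<in> \<B>} \<noteq> {}" using G.nonempty H.nonempty by blast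
  next
    fix P assume "P \<in> {A \<times> B | A B. A \<in> \<A> \<and> B \<in> \<B>}"
    then obtain A B where P: "P = A \<times> B" "A \<in> \<A>" "B \<in> \<B>" by blast
    then show "P \<subseteq> carrier (G \<times>\<times> H)" "\<one>\<^bsub>G \<times>\<times> H\<^esub> \<in> P"
      using G.base_subset H.base_subset G.base_one H.base_one by auto
    obtain C D where "C \<in> \<A>" "\<forall>x\<in>C. \<forall>y\<in>C. x \<otimes>\<^bsub>G\<^esub> y \<in> A" "D \<in> \<B>" "\<forall>x\<in>D. \<forall>y\<in>D. x \<otimes>\<^bsub>H\<^esub> y \<in> B"
      using G.base_mult H.base_mult P by metis
    then show "\<exists>Q\<in>{A \<times> B | A B. A \<in> \<A> \<and> B \<in> \<B>}. \<forall>x\<in>Q. \<forall>y\<in>Q. x \<otimes>\<^bsub>G \<times>\<times> H\<^esub> y \<in> P"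
      using P by (intro bexI[of _ "C \<times> D"]) auto
    obtain C D where C: "C \<in> \<A>" "\<forall>x\<in>C. inv\<^bsub>G\<^esub> x \<in> A" "D \<in> \<B>" "\<forall>x\<in>D. inv\<^bsub>H\<^esub> x \<in> B"
      using G.base_inv H.base_inv P by metis
    then have "C \<subseteq> carrier G" "D \<subseteq> carrier H" using G.base_subset H.base_subset by auto
    then show "\<exists>Q\<in>{A \<times> B | A B. A \<in> \<A> \<and> B \<in> \<B>}. \<forall>x\<in>Q. inv\<^bsub>G \<times>\<times> H\<^esub> x \<in> P"
      using P C by (intro bexI[of _ "C \<times> D"]) (auto simp: inv_DirProd subset_eq)
    fix g assume "g \<in> carrier (G \<times>\<times> H)"
    then obtain a b where g: "g = (a, b)" "a \<in> carrier G" "b \<in> carrier H" by auto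
    then obtain C D where C: "C \<in> \<A>" "\<forall>x\<in>C. a \<otimes>\<^bsub>G\<^esub> x \<otimes>\<^bsub>G\<^esub> inv\<^bsub>G\<^esub> a \<in> A"
      "D \<in> \<B>" "\<forall>x\<in>D. b \<otimes>\<^bsub>H\<^esub> x \<otimes>\<^bsub>H\<^esub> inv\<^bsub>H\<^esub> b \<in> B"
      using G.base_conj H.base_conj P by metis
    then show "\<exists>Q\<in>{A \<times> B | A B. A \<in> \<A> \<and> B \<in> \<B>}.
        \<forall>x\<in>Q. g \<otimes>\<^bsub>G \<times>\<times> H\<^esub> x \<otimes>\<^bsub>G \<times>\<times> H\<^esub> inv\<^bsub>G \<times>\<times> H\<^esub> g \<in> P"
      using P g by (intro bexI[of _ "C \<times> D"]) auto
  next
    fix P Q assume "P \<in> {A \<times> B | A B. A \<in> \<A> \<and> B \<in> \<B>}" "Q \<in> {A \<times> B | A B. A \<in> \<A> \<and> B \<in> \<B>}"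
    then obtain A B A' B' where P: "P = A \<times> B" "A \<in> \<A>" "B \<in> \<B>" "Q = A' \<times> B'" "A' \<in> \<A>" "B' \<in> \<B>"
      by blast
    then obtain C D where "C \<in> \<A>" "C \<subseteq> A \<inter> A'" "D \<in> \<B>" "D \<subseteq> B \<inter> B'"
      using G.base_directed H.base_directed by meson
    then show "\<exists>R\<in>{A \<times> B | A B. A \<in> \<A> \<and> B \<in> \<B>}. R \<subseteq> P \<inter> Q"
      using P by (intro bexI[of _ "C \<times> D"]) auto
  qed
qed

context topological_group
begin

abbreviation nbhd :: "'a set \<Rightarrow> bool" where "nbhd \<equiv> unit_nbhd G T"

lemma nbhd_subset: "nbhd U \<Longrightarrow> U \<subseteq> carrier G"
  by (simp add: unit_nbhd_def topspace_eq)

lemma nbhd_one: "nbhd U \<Longrightarrow> \<one> \<in> U"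
  by (auto simp: unit_nbhd_def)

lemma nbhd_carrier: "nbhd (carrier G)"
  unfolding unit_nbhd_def using topspace_eq by (metis one_closed openin_topspace order_refl)

lemma nbhd_mono: "nbhd U \<Longrightarrow> U \<subseteq> V \<Longrightarrow> V \<subseteq> carrier G \<Longrightarrow> nbhd V"
  unfolding unit_nbhd_def topspace_eq by blast

lemma nbhd_Int: "nbhd U \<Longrightarrow> nbhd V \<Longrightarrow> nbhd (U \<inter> V)"
  unfolding unit_nbhd_def by (meson Int_iff inf_mono le_infI1 openin_Int)

lemma open_nbhd: "openin T U \<Longrightarrow> \<one> \<in> U \<Longrightarrow> nbhd U"
  unfolding unit_nbhd_def using openin_subset by blast

lemma nbhd_preimage:
  assumes "continuous_map T T f" "f \<one> = \<one>" "nbhd U"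
  shows "nbhd {x \<in> carrier G. f x \<in> U}"
proof -
  obtain W where W: "openin T W" "\<one> \<in> W" "W \<subseteq> U" using assms by (auto simp: unit_nbhd_def)
  have "openin T {x \<in> topspace T. f x \<in> W}" using assms W by (simp add: continuous_map_def)
  then have "nbhd {x \<in> topspace T. f x \<in> W}"
    using W assms(2) by (intro open_nbhd) (auto simp: topspace_eq)
  then show ?thesis
    by (rule nbhd_mono) (use W in \<open>auto simp: topspace_eq\<close>)
qed

lemma continuous_lmult: "x \<in> carrier G \<Longrightarrow> continuous_map T T (\<lambda>y. x \<otimes> y)"
  using continuous_map_compose[OF _ continuous_mult, of T "\<lambda>y. (x, y)"]
  by (simp add: o_def continuous_map_paired topspace_eq)

lemma continuous_rmult: "x \<in> carrier G \<Longrightarrow> continuous_map T T (\<lambda>y. y \<otimes> x)"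
  using continuous_map_compose[OF _ continuous_mult, of T "\<lambda>y. (y, x)"]
  by (simp add: o_def continuous_map_paired topspace_eq)

lemma unit_nbhd_filter_base: "unit_filter_base G {U. nbhd U}"
proof (unfold_locales, safe)
  show "{U. nbhd U} = {} \<Longrightarrow> False" using nbhd_carrier by blast
  show "x \<in> carrier G" if "nbhd B" "x \<in> B" for x B using that nbhd_subset by blast
  show "\<one> \<in> B" if "nbhd B" for B using that by (rule nbhd_one)
  show "\<exists>C\<in>{U. nbhd U}. C \<subseteq> B \<inter> B'" if "nbhd B" "nbhd B'" for B B'
    using nbhd_Int[OF that] by blast
  show "\<exists>C\<in>{U. nbhd U}. \<forall>x\<in>C. inv x \<in> B" if "nbhd B" for B
    using nbhd_preimage[OF continuous_inv _ that] by auto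
  show "\<exists>C\<in>{U. nbhd U}. \<forall>x\<in>C. g \<otimes> x \<otimes> inv g \<in> B" if "nbhd B" "g \<in> carrier G" for B g
  proof -
    have "continuous_map T T (\<lambda>x. g \<otimes> x \<otimes> inv g)"
      using continuous_map_compose[OF continuous_lmult[of g] continuous_rmult[of "inv g"]] that
      by (simp add: o_def)
    then show ?thesis using nbhd_preimage[of "\<lambda>x. g \<otimes> x \<otimes> inv g"] that by auto
  qed
  show "\<exists>C\<in>{U. nbhd U}. \<forall>x\<in>C. \<forall>y\<in>C. x \<otimes> y \<in> B" if B: "nbhd B" for B
  proof -
    obtain W where W: "openin T W" "\<one> \<in> W" "W \<subseteq> B" using B by (auto simp: unit_nbhd_def)
    let ?P = "{p \<in> carrier G \<times> carrier G. (case p of (x, y) \<Rightarrow> x \<otimes> y) \<in> W}"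
    have "openin (prod_topology T T) ?P"
      using continuous_mult W by (simp add: continuous_map_def topspace_eq)
    moreover have "(\<one>, \<one>) \<in> ?P" using W by simp
    ultimately have "\<exists>U V. openin T U \<and> openin T V \<and> \<one> \<in> U \<and> \<one> \<in> V \<and> U \<times> V \<subseteq> ?P"
      unfolding openin_prod_topology_alt by simp
    then obtain U V where UV: "openin T U" "openin T V" "\<one> \<in> U" "\<one> \<in> V" "U \<times> V \<subseteq> ?P"
      by (elim exE conjE)
    then have "nbhd (U \<inter> V)" by (intro open_nbhd) auto
    moreover have "x \<otimes> y \<in> B" if "x \<in> U \<inter> V" "y \<in> U \<inter> V" for x y
    proof -
      have "(x, y) \<in> ?P" using that by (intro subsetD[OF UV(5)]) simp
      then show ?thesis using W(3) by auto
    qed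
    ultimately show ?thesis by auto
  qed
qed

sublocale nbhds: unit_filter_base G "{U. nbhd U}"
  by (rule unit_nbhd_filter_base)

lemma nbhd_multE:
  assumes "nbhd U" obtains V where "nbhd V" "\<And>x y. x \<in> V \<Longrightarrow> y \<in> V \<Longrightarrow> x \<otimes> y \<in> U"
  using nbhds.base_mult[of U] assms by blast

lemma nbhd_invE:
  assumes "nbhd U" obtains V where "nbhd V" "\<And>x. x \<in> V \<Longrightarrow> inv x \<in> U"
  using nbhds.base_inv[of U] assms by blast

lemma nbhd_conjE:
  assumes "nbhd U" "g \<in> carrier G"
  obtains V where "nbhd V" "\<And>x. x \<in> V \<Longrightarrow> g \<otimes> x \<otimes> inv g \<in> U"
  using nbhds.base_conj[of U g] assms by blast

lemma nbhd_symmetric_cubeE: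
  assumes U: "nbhd U"
  obtains V where "nbhd V" "V \<subseteq> U" "\<And>x. x \<in> V \<Longrightarrow> inv x \<in> V"
    "\<And>x y z. x \<in> V \<Longrightarrow> y \<in> V \<Longrightarrow> z \<in> V \<Longrightarrow> x \<otimes> y \<otimes> z \<in> U"
proof -
  obtain A where A: "nbhd A" "\<And>x y. x \<in> A \<Longrightarrow> y \<in> A \<Longrightarrow> x \<otimes> y \<in> U"
    using nbhd_multE[OF U] by blast
  obtain B where B: "nbhd B" "\<And>x y. x \<in> B \<Longrightarrow> y \<in> B \<Longrightarrow> x \<otimes> y \<in> A"
    using nbhd_multE[OF A(1)] by blast
  obtain C where C: "nbhd C" "\<And>x. x \<in> C \<Longrightarrow> inv x \<in> A \<inter> B"
    using nbhd_invE[OF nbhd_Int[OF A(1) B(1)]] by blast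
  define V where "V = {x \<in> A \<inter> B. inv x \<in> A \<inter> B}"
  have AG: "A \<subseteq> carrier G" using A nbhd_subset by blast
  have "A \<inter> B \<inter> C \<subseteq> V" using C by (auto simp: V_def)
  then have "nbhd V" using nbhd_mono[OF nbhd_Int[OF nbhd_Int[OF A(1) B(1)] C(1)]] AG by (auto simp: V_def)
  moreover have "V \<subseteq> U"
  proof
    fix x assume "x \<in> V"
    then have "x \<otimes> \<one> \<in> U" "x \<in> carrier G" using A nbhd_one AG by (auto simp: V_def)
    then show "x \<in> U" by simp
  qed
  moreover have "inv x \<in> V" if "x \<in> V" for x using that AG by (auto simp: V_def)
  moreover have "x \<otimes> y \<otimes> z \<in> U" if "x \<in> V" "y \<in> V" "z \<in> V" for x y z
    using that A B by (auto simp: V_def)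
  ultimately show thesis using that by blast
qed

lemma nbhd_translate:
  assumes "openin T S" "x \<in> S"
  shows "nbhd {u \<in> carrier G. x \<otimes> u \<in> S}"
proof -
  have x: "x \<in> carrier G" using assms openin_subset topspace_eq by blast
  then have "openin T {u \<in> topspace T. x \<otimes> u \<in> S}"
    using continuous_lmult[of x] assms by (simp add: continuous_map_def)
  then show ?thesis using assms x by (intro open_nbhd) (auto simp: topspace_eq)
qed

lemma openin_iff_nbhd:
  "openin T S \<longleftrightarrow> S \<subseteq> carrier G \<and> (\<forall>x\<in>S. \<exists>U. nbhd U \<and> (\<forall>u\<in>U. x \<otimes> u \<in> S))"
proof (intro iffI conjI ballI)
  assume S: "openin T S"
  then show "S \<subseteq> carrier G" using openin_subset topspace_eq by blast
  show "\<exists>U. nbhd U \<and> (\<forall>u\<in>U. x \<otimes> u \<in> S)" if "x \<in> S" for x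
    using nbhd_translate[OF S that] by blast
next
  assume S: "S \<subseteq> carrier G \<and> (\<forall>x\<in>S. \<exists>U. nbhd U \<and> (\<forall>u\<in>U. x \<otimes> u \<in> S))"
  show "openin T S"
    unfolding openin_subopen[of T S]
  proof
    fix x assume x: "x \<in> S"
    then have xG: "x \<in> carrier G" using S by blast
    obtain U where "nbhd U" "\<forall>u\<in>U. x \<otimes> u \<in> S" using S x by blast
    then obtain W where W: "openin T W" "\<one> \<in> W" "\<forall>u\<in>W. x \<otimes> u \<in> S"
      unfolding unit_nbhd_def by blast
    have "openin T {y \<in> topspace T. inv x \<otimes> y \<in> W}"
      using continuous_lmult[of "inv x"] W xG by (simp add: continuous_map_def)
    moreover have "y \<in> S" if "y \<in> carrier G" "inv x \<otimes> y \<in> W" for y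
      using W(3) that xG by (metis inv_mult_cancel(2))
    ultimately show "\<exists>V. openin T V \<and> x \<in> V \<and> V \<subseteq> S"
      using xG W(2) by (intro exI[of _ "{y \<in> topspace T. inv x \<otimes> y \<in> W}"]) (auto simp: topspace_eq)
  qed
qed

lemma in_closure_iff_nbhd:
  "x \<in> T closure_of A \<longleftrightarrow> x \<in> carrier G \<and> (\<forall>U. nbhd U \<longrightarrow> (\<exists>u\<in>U. x \<otimes> u \<in> A))"
proof (intro iffI conjI allI impI)
  assume x: "x \<in> T closure_of A"
  then show xG: "x \<in> carrier G" by (simp add: in_closure_of topspace_eq)
  fix U assume "nbhd U"
  then obtain W where W: "openin T W" "\<one> \<in> W" "W \<subseteq> U" by (auto simp: unit_nbhd_def)
  define S where "S = {y \<in> topspace T. inv x \<otimes> y \<in> W}"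
  have "openin T S"
    using continuous_lmult[of "inv x"] W xG by (simp add: continuous_map_def S_def)
  moreover have "x \<in> S" using xG W by (simp add: topspace_eq S_def)
  ultimately have "\<exists>y. y \<in> A \<and> y \<in> S"
    using x by (simp add: in_closure_of)
  then obtain y where "y \<in> A" "y \<in> topspace T" "inv x \<otimes> y \<in> W" unfolding S_def by blast
  then show "\<exists>u\<in>U. x \<otimes> u \<in> A" using W xG topspace_eq
    by (intro bexI[of _ "inv x \<otimes> y"]) auto
next
  assume x: "x \<in> carrier G \<and> (\<forall>U. nbhd U \<longrightarrow> (\<exists>u\<in>U. x \<otimes> u \<in> A))"
  show "x \<in> T closure_of A"
    unfolding in_closure_of topspace_eq
  proof (intro conjI allI impI)
    fix S assume "x \<in> S \<and> openin T S"
    then have "nbhd {u \<in> carrier G. x \<otimes> u \<in> S}" using nbhd_translate by blast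
    with x show "\<exists>y. y \<in> A \<and> y \<in> S" by blast
  qed (use x in blast)
qed

end

section \<open>What closedness of injective images gives\<close>

text \<open>This is the only form in which \<open>i:TG\<close>-closedness is applied to constructed groups:
divide \<open>\<Gamma>\<close> by the closure of its unit to obtain a Hausdorff group; a point
\<open>g\<close> that is approximated by the image of \<open>\<phi>\<close> then agrees with some
\<open>\<phi> x\<close> up to a factor in every basic neighborhood.\<close>

proposition iTG_closed_absorbs_limits:
  fixes X :: "('a, 'm) monoid_scheme" and \<Gamma> :: "('b, 'n) monoid_scheme"
  assumes X: "topological_group X T" and closed: "iTG_closed TYPE('a set set) X T"
    and base: "unit_filter_base \<Gamma> \<B>" and hom: "\<phi> \<in> hom X \<Gamma>"
    and cont: "\<And>B. B \<in> \<B> \<Longrightarrow> \<exists>U. unit_nbhd X T U \<and> \<phi> ` U \<subseteq> B"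
    and inj: "\<And>x. x \<in> carrier X \<Longrightarrow> (\<And>B. B \<in> \<B> \<Longrightarrow> \<phi> x \<in> B) \<Longrightarrow> x = \<one>\<^bsub>X\<^esub>"
    and g: "g \<in> carrier \<Gamma>"
    and approx: "\<And>B. B \<in> \<B> \<Longrightarrow> \<exists>x\<in>carrier X. inv\<^bsub>\<Gamma>\<^esub> g \<otimes>\<^bsub>\<Gamma>\<^esub> \<phi> x \<in> B"
  shows "\<exists>x\<in>carrier X. \<forall>B\<in>\<B>. inv\<^bsub>\<Gamma>\<^esub> g \<otimes>\<^bsub>\<Gamma>\<^esub> \<phi> x \<in> B"
proof -
  interpret X: topological_group X T by fact
  interpret \<Gamma>: unit_filter_base \<Gamma> \<B> by fact
  interpret \<phi>: group_hom X \<Gamma> \<phi> by unfold_locales (rule hom)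
  let ?f = "\<lambda>x. \<Gamma>.proj (\<phi> x)"
  have "inj_cont_hom X T (\<Gamma> Mod \<Gamma>.core) \<Gamma>.quotient_topology ?f"
    unfolding inj_cont_hom_def
  proof (intro conjI)
    show "?f \<in> hom X (\<Gamma> Mod \<Gamma>.core)"
    proof (rule homI)
      show "?f x \<in> carrier (\<Gamma> Mod \<Gamma>.core)" if "x \<in> carrier X" for x
        using that by (simp add: \<Gamma>.carrier_Mod)
      show "?f (x \<otimes>\<^bsub>X\<^esub> y) = ?f x \<otimes>\<^bsub>\<Gamma> Mod \<Gamma>.core\<^esub> ?f y" if "x \<in> carrier X" "y \<in> carrier X" for x y
        using that by (simp add: \<Gamma>.proj_mult)
    qed
    show "inj_on ?f (carrier X)"
    proof (rule inj_onI)
      fix x y assume xy: "x \<in> carrier X" "y \<in> carrier X" "?f x = ?f y"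
      then have "\<phi> (inv\<^bsub>X\<^esub> x \<otimes>\<^bsub>X\<^esub> y) \<in> \<Gamma>.core" by (simp add: \<Gamma>.proj_eq_iff)
      then have "inv\<^bsub>X\<^esub> x \<otimes>\<^bsub>X\<^esub> y = \<one>\<^bsub>X\<^esub>" using inj xy by (simp add: \<Gamma>.core_def)
      then show "x = y" using xy by (metis X.inv_mult_cancel(2) X.r_one)
    qed
    show "continuous_map T \<Gamma>.quotient_topology ?f"
      unfolding continuous_map_def
    proof (intro conjI allI impI)
      show "?f \<in> topspace T \<rightarrow> topspace \<Gamma>.quotient_topology"
        by (simp add: \<Gamma>.topspace_quotient X.topspace_eq)
      fix U assume U: "openin \<Gamma>.quotient_topology U"
      show "openin T {x \<in> topspace T. ?f x \<in> U}"
        unfolding X.openin_iff_nbhd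
      proof (intro conjI ballI)
        fix x assume "x \<in> {x \<in> topspace T. ?f x \<in> U}"
        then have x: "x \<in> carrier X" "?f x \<in> U" by (auto simp: X.topspace_eq)
        then obtain B where B: "B \<in> \<B>" "\<forall>b\<in>B. \<Gamma>.proj (\<phi> x \<otimes>\<^bsub>\<Gamma>\<^esub> b) \<in> U"
          using U \<phi>.hom_closed unfolding \<Gamma>.openin_quotient by metis
        obtain V where V: "X.nbhd V" "\<phi> ` V \<subseteq> B" using cont B by blast
        then have "x \<otimes>\<^bsub>X\<^esub> u \<in> {x \<in> topspace T. ?f x \<in> U}" if "u \<in> V" for u
          using that x B X.nbhd_subset[OF V(1)] by (auto simp: X.topspace_eq subset_eq)
        then show "\<exists>V. X.nbhd V \<and> (\<forall>u\<in>V. x \<otimes>\<^bsub>X\<^esub> u \<in> {x \<in> topspace T. ?f x \<in> U})"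
          using V by blast
      qed (auto simp: X.topspace_eq)
    qed
  qed
  then have clo: "closedin \<Gamma>.quotient_topology (?f ` carrier X)"
    using iTG_closed_all_types[OF X closed, where 'y = "'b set"] \<Gamma>.quotient_topological_group
    unfolding iTG_closed_def by blast
  have "\<Gamma>.proj g \<in> ?f ` carrier X"
  proof (rule ccontr)
    assume "\<Gamma>.proj g \<notin> ?f ` carrier X"
    then have "\<Gamma>.proj g \<in> topspace \<Gamma>.quotient_topology - ?f ` carrier X"
      using g by (simp add: \<Gamma>.topspace_quotient)
    moreover have "openin \<Gamma>.quotient_topology (topspace \<Gamma>.quotient_topology - ?f ` carrier X)"
      using clo by (simp add: closedin_def)
    ultimately obtain B where B: "B \<in> \<B>"
        "\<forall>b\<in>B. \<Gamma>.proj (g \<otimes>\<^bsub>\<Gamma>\<^esub> b) \<in> topspace \<Gamma>.quotient_topology - ?f ` carrier X"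
      using g unfolding \<Gamma>.openin_quotient by metis
    obtain x where "x \<in> carrier X" "inv\<^bsub>\<Gamma>\<^esub> g \<otimes>\<^bsub>\<Gamma>\<^esub> \<phi> x \<in> B" using approx B by blast
    moreover have "g \<otimes>\<^bsub>\<Gamma>\<^esub> (inv\<^bsub>\<Gamma>\<^esub> g \<otimes>\<^bsub>\<Gamma>\<^esub> \<phi> x) = \<phi> x" using g \<open>x \<in> carrier X\<close> by simp
    ultimately show False using B by force
  qed
  then obtain x where "x \<in> carrier X" "\<Gamma>.proj g = ?f x" by blast
  then have "inv\<^bsub>\<Gamma>\<^esub> g \<otimes>\<^bsub>\<Gamma>\<^esub> \<phi> x \<in> \<Gamma>.core" using g by (simp add: \<Gamma>.proj_eq_iff)
  then show ?thesis using \<open>x \<in> carrier X\<close> by (auto simp: \<Gamma>.core_def)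
qed

section \<open>Narrow sets and the subgroups that they generate\<close>

context topological_group
begin

lemma nbhd_Inter_trivial:
  assumes "x \<in> carrier G" "\<And>U. nbhd U \<Longrightarrow> x \<in> U"
  shows "x = \<one>"
proof (rule ccontr)
  assume "x \<noteq> \<one>"
  then obtain U V where "openin T U" "\<one> \<in> U" "x \<in> V" "disjnt U V"
    using Hausdorff assms(1) unfolding Hausdorff_space_def topspace_eq by (metis one_closed)
  then show False using assms(2)[OF open_nbhd] by (auto simp: disjnt_iff)
qed

text \<open>The one-sided half of \<open>\<omega>\<close>-narrowness. It is easier to handle, and for sets
that are closed under inverses it is equivalent to the two-sided notion.\<close>

definition left_narrow :: "'a set \<Rightarrow> bool" where
  "left_narrow B \<longleftrightarrow> B \<subseteq> carrier G \<and>
    (\<forall>U. nbhd U \<longrightarrow> (\<exists>C. countable C \<and> C \<subseteq> carrier G \<and> (\<forall>b\<in>B. \<exists>c\<in>C. inv c \<otimes> b \<in> U)))"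

lemma left_narrow_mono: "left_narrow B \<Longrightarrow> A \<subseteq> B \<Longrightarrow> left_narrow A"
  unfolding left_narrow_def by (meson subset_eq)

lemma omega_narrow_iff_left_narrow:
  "omega_narrow G T B \<longleftrightarrow> left_narrow B \<and> left_narrow ((\<lambda>b. inv b) ` B)"
proof
  assume B: "omega_narrow G T B"
  then have BG: "B \<subseteq> carrier G" by (simp add: omega_narrow_def)
  show "left_narrow B \<and> left_narrow ((\<lambda>b. inv b) ` B)"
    unfolding left_narrow_def
  proof (intro conjI allI impI)
    fix U assume U: "nbhd U"
    obtain C where C: "countable C" "C \<subseteq> carrier G" "B \<subseteq> C <#> U"
      using B U unfolding omega_narrow_def by (meson le_inf_iff)
    have "\<exists>c\<in>C. inv c \<otimes> b \<in> U" if "b \<in> B" for b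
    proof -
      obtain c u where "c \<in> C" "u \<in> U" "b = c \<otimes> u"
        using C(3) \<open>b \<in> B\<close> by (auto simp: set_mult_def)
      then have "inv c \<otimes> b = u" using C(2) nbhd_subset[OF U] by (auto simp: subset_eq)
      then show ?thesis using \<open>c \<in> C\<close> \<open>u \<in> U\<close> by blast
    qed
    then show "\<exists>C. countable C \<and> C \<subseteq> carrier G \<and> (\<forall>b\<in>B. \<exists>c\<in>C. inv c \<otimes> b \<in> U)"
      using C by blast
  next
    fix U assume U: "nbhd U"
    obtain V where V: "nbhd V" "\<And>x. x \<in> V \<Longrightarrow> inv x \<in> U" using nbhd_invE[OF U] by blast
    obtain C where C: "countable C" "C \<subseteq> carrier G" "B \<subseteq> V <#> C"
      using B V(1) unfolding omega_narrow_def by (meson le_inf_iff)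
    have "\<exists>c\<in>(\<lambda>c. inv c) ` C. inv c \<otimes> inv b \<in> U" if "b \<in> B" for b
    proof -
      obtain c v where cv: "c \<in> C" "v \<in> V" "b = v \<otimes> c"
        using C(3) \<open>b \<in> B\<close> by (auto simp: set_mult_def)
      then have "inv (inv c) \<otimes> inv b = inv v" using C(2) nbhd_subset[OF V(1)]
        by (auto simp: word_simps subset_eq)
      then show ?thesis using cv V(2)[OF cv(2)] by (intro bexI[of _ "inv c"]) auto
    qed
    then show "\<exists>C. countable C \<and> C \<subseteq> carrier G \<and> (\<forall>b\<in>(\<lambda>b. inv b) ` B. \<exists>c\<in>C. inv c \<otimes> b \<in> U)"
      using C by (intro exI[of _ "(\<lambda>c. inv c) ` C"]) auto
  qed (use BG in auto)
next
  assume B: "left_narrow B \<and> left_narrow ((\<lambda>b. inv b) ` B)"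
  then have BG: "B \<subseteq> carrier G" by (simp add: left_narrow_def)
  show "omega_narrow G T B"
    unfolding omega_narrow_def
  proof (intro conjI allI impI)
    fix U assume U: "nbhd U"
    obtain C where C: "countable C" "C \<subseteq> carrier G" "\<forall>b\<in>B. \<exists>c\<in>C. inv c \<otimes> b \<in> U"
      using B U unfolding left_narrow_def by meson
    obtain V where V: "nbhd V" "\<And>x. x \<in> V \<Longrightarrow> inv x \<in> U" using nbhd_invE[OF U] by blast
    obtain D where D: "countable D" "D \<subseteq> carrier G" "\<forall>b\<in>(\<lambda>b. inv b) ` B. \<exists>c\<in>D. inv c \<otimes> b \<in> V"
      using B V(1) unfolding left_narrow_def by meson
    define E where "E = C \<union> (\<lambda>d. inv d) ` D"
    have "b \<in> E <#> U" if b: "b \<in> B" for b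
    proof -
      obtain c where c: "c \<in> C" "inv c \<otimes> b \<in> U" using C(3) b by blast
      moreover have "c \<in> carrier G" "b \<in> carrier G" using c C(2) BG b by blast+
      then have "b = c \<otimes> (inv c \<otimes> b)" by simp
      ultimately show ?thesis unfolding set_mult_def E_def by blast
    qed
    moreover have "b \<in> U <#> E" if b: "b \<in> B" for b
    proof -
      obtain d where d: "d \<in> D" "inv d \<otimes> inv b \<in> V" using D(3) b by blast
      have car: "d \<in> carrier G" "b \<in> carrier G" using d D BG b by auto
      have "inv (inv d \<otimes> inv b) \<in> U" using V d by blast
      then have "b \<otimes> d \<in> U" using car by (simp add: word_simps)
      moreover have "b = (b \<otimes> d) \<otimes> inv d" using car by (simp add: word_simps)
      ultimately show ?thesis using d unfolding set_mult_def E_def by blast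
    qed
    moreover have "countable E" "E \<subseteq> carrier G" using C D by (auto simp: E_def)
    ultimately show "\<exists>C. countable C \<and> C \<subseteq> carrier G \<and> B \<subseteq> (C <#> U) \<inter> (U <#> C)"
      by blast
  qed (rule BG)
qed

text \<open>Approximating a product \<open>a b\<close> from the left, first replace \<open>b\<close> by one of
countably many centers \<open>c\<close>. The accuracy needed for \<open>a\<close> depends on \<open>c\<close>
by conjugation, but countably many centers \<open>d\<close> for each \<open>c\<close> still give only
countably many products \<open>d c\<close>.\<close>

lemma left_narrow_mult:
  assumes A: "left_narrow A" and B: "left_narrow B"
  shows "left_narrow (A <#> B)"
  unfolding left_narrow_def
proof (intro conjI allI impI)
  have AG: "A \<subseteq> carrier G" and BG: "B \<subseteq> carrier G" using A B by (auto simp: left_narrow_def)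
  then show "A <#> B \<subseteq> carrier G" by (rule set_mult_closed)
  fix U assume U: "nbhd U"
  obtain V where V: "nbhd V" "\<And>x y. x \<in> V \<Longrightarrow> y \<in> V \<Longrightarrow> x \<otimes> y \<in> U" using nbhd_multE[OF U] by blast
  obtain C where C: "countable C" "C \<subseteq> carrier G" "\<forall>b\<in>B. \<exists>c\<in>C. inv c \<otimes> b \<in> V"
    using B V(1) unfolding left_narrow_def by meson
  have "\<exists>D. countable D \<and> D \<subseteq> carrier G \<and> (\<forall>a\<in>A. \<exists>d\<in>D. inv c \<otimes> (inv d \<otimes> a) \<otimes> c \<in> V)" if "c \<in> C" for c
  proof -
    have c: "c \<in> carrier G" using that C by blast
    obtain W where W: "nbhd W" "\<And>x. x \<in> W \<Longrightarrow> inv c \<otimes> x \<otimes> inv (inv c) \<in> V"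
      using nbhd_conjE[OF V(1), of "inv c"] c by blast
    obtain D where "countable D" "D \<subseteq> carrier G" "\<forall>b\<in>A. \<exists>d\<in>D. inv d \<otimes> b \<in> W"
      using A W(1) unfolding left_narrow_def by meson
    then show ?thesis using W(2) c by (metis inv_inv)
  qed
  then obtain D where D: "\<And>c. c \<in> C \<Longrightarrow> countable (D c)" "\<And>c. c \<in> C \<Longrightarrow> D c \<subseteq> carrier G"
    "\<And>c a. c \<in> C \<Longrightarrow> a \<in> A \<Longrightarrow> \<exists>d\<in>D c. inv c \<otimes> (inv d \<otimes> a) \<otimes> c \<in> V"
    by metis
  define E where "E = (\<Union>c\<in>C. (\<lambda>d. d \<otimes> c) ` D c)"
  have "countable E" unfolding E_def using C D by auto
  moreover have "E \<subseteq> carrier G" unfolding E_def using C(2) D(2) by blast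
  moreover have "\<exists>e\<in>E. inv e \<otimes> p \<in> U" if p: "p \<in> A <#> B" for p
  proof -
    obtain a b where ab: "a \<in> A" "b \<in> B" "p = a \<otimes> b" using p by (auto simp: set_mult_def)
    obtain c where c: "c \<in> C" "inv c \<otimes> b \<in> V" using C ab by blast
    obtain d where d: "d \<in> D c" "inv c \<otimes> (inv d \<otimes> a) \<otimes> c \<in> V" using D(3) c ab by blast
    have car: "a \<in> carrier G" "b \<in> carrier G" "c \<in> carrier G" "d \<in> carrier G"
      using ab c d AG BG C D(2) by blast+
    have "inv c \<otimes> (inv d \<otimes> a) \<otimes> c \<otimes> (inv c \<otimes> b) \<in> U" using V c d by blast
    then have "inv (d \<otimes> c) \<otimes> p \<in> U" using car ab by (simp add: word_simps)
    then show ?thesis using c d unfolding E_def by blast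
  qed
  ultimately show "\<exists>C. countable C \<and> C \<subseteq> carrier G \<and> (\<forall>b\<in>A <#> B. \<exists>c\<in>C. inv c \<otimes> b \<in> U)"
    by blast
qed

lemma left_narrow_UN:
  assumes "countable I" "\<And>i. i \<in> I \<Longrightarrow> left_narrow (B i)"
  shows "left_narrow (\<Union>i\<in>I. B i)"
  unfolding left_narrow_def
proof (intro conjI allI impI)
  show "(\<Union>i\<in>I. B i) \<subseteq> carrier G" using assms by (auto simp: left_narrow_def)
  fix U assume U: "nbhd U"
  then have "\<exists>C. countable C \<and> C \<subseteq> carrier G \<and> (\<forall>b\<in>B i. \<exists>c\<in>C. inv c \<otimes> b \<in> U)" if "i \<in> I" for i
    using assms(2)[OF that] unfolding left_narrow_def by blast
  then obtain C where C: "\<And>i. i \<in> I \<Longrightarrow> countable (C i)" "\<And>i. i \<in> I \<Longrightarrow> C i \<subseteq> carrier G"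
    "\<And>i b. i \<in> I \<Longrightarrow> b \<in> B i \<Longrightarrow> \<exists>c\<in>C i. inv c \<otimes> b \<in> U" by metis
  have "countable (\<Union>i\<in>I. C i)" using C assms(1) by auto
  then show "\<exists>C. countable C \<and> C \<subseteq> carrier G \<and> (\<forall>b\<in>\<Union>i\<in>I. B i. \<exists>c\<in>C. inv c \<otimes> b \<in> U)"
  proof (intro exI[of _ "\<Union>i\<in>I. C i"] conjI ballI)
    fix b assume "b \<in> (\<Union>i\<in>I. B i)"
    then obtain i where "i \<in> I" "b \<in> B i" by blast
    then show "\<exists>c\<in>\<Union>i\<in>I. C i. inv c \<otimes> b \<in> U" using C(3)[of i b] by auto
  qed (use C(2) in auto)
qed

lemma left_narrow_finite: "finite F \<Longrightarrow> F \<subseteq> carrier G \<Longrightarrow> left_narrow F"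
  unfolding left_narrow_def
proof (intro conjI allI impI)
  fix U assume F: "finite F" "F \<subseteq> carrier G" and U: "nbhd U"
  have "\<exists>c\<in>F. inv c \<otimes> b \<in> U" if "b \<in> F" for b
    using that F nbhd_one[OF U] by (intro bexI[of _ b]) auto
  then show "\<exists>C. countable C \<and> C \<subseteq> carrier G \<and> (\<forall>b\<in>F. \<exists>c\<in>C. inv c \<otimes> b \<in> U)"
    using F by (intro exI[of _ F]) (simp add: countable_finite)
qed

lemma left_narrow_Un: "left_narrow A \<Longrightarrow> left_narrow B \<Longrightarrow> left_narrow (A \<union> B)"
  using left_narrow_UN[of "{True, False}" "\<lambda>b. if b then A else B"] by (simp add: Un_commute)

lemma left_narrow_closure:
  assumes A: "left_narrow A"
  shows "left_narrow (T closure_of A)"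
  unfolding left_narrow_def
proof (intro conjI allI impI)
  show "T closure_of A \<subseteq> carrier G" using closure_of_subset_topspace topspace_eq by metis
  fix U assume U: "nbhd U"
  obtain V where V: "nbhd V" "\<And>x. x \<in> V \<Longrightarrow> inv x \<in> V"
    "\<And>x y z. x \<in> V \<Longrightarrow> y \<in> V \<Longrightarrow> z \<in> V \<Longrightarrow> x \<otimes> y \<otimes> z \<in> U"
    using nbhd_symmetric_cubeE[OF U] by metis
  obtain C where C: "countable C" "C \<subseteq> carrier G" "\<forall>b\<in>A. \<exists>c\<in>C. inv c \<otimes> b \<in> V"
    using A V(1) unfolding left_narrow_def by meson
  have "\<exists>c\<in>C. inv c \<otimes> b \<in> U" if b: "b \<in> T closure_of A" for b
  proof -
    obtain v where v: "v \<in> V" "b \<otimes> v \<in> A" and bG: "b \<in> carrier G"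
      using b V(1) unfolding in_closure_iff_nbhd by blast
    obtain c where c: "c \<in> C" "inv c \<otimes> (b \<otimes> v) \<in> V" using C v by blast
    have car: "c \<in> carrier G" "v \<in> carrier G" using c C v nbhd_subset[OF V(1)] by auto
    have "inv c \<otimes> (b \<otimes> v) \<otimes> inv v \<otimes> \<one> \<in> U" using V(2) V(3) v c nbhd_one[OF V(1)] by blast
    then have "inv c \<otimes> b \<in> U" using car bG by (simp add: word_simps)
    then show ?thesis using c by blast
  qed
  then show "\<exists>C. countable C \<and> C \<subseteq> carrier G \<and> (\<forall>b\<in>T closure_of A. \<exists>c\<in>C. inv c \<otimes> b \<in> U)"
    using C by blast
qed

text \<open>The sets \<open>P n\<close> of the proof arise by repeated squaring: they increase, so their union
is closed under products, and each of them is narrow.\<close>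

lemma left_narrow_generate:
  assumes S: "left_narrow S" "left_narrow ((\<lambda>x. inv x) ` S)"
  shows "left_narrow (generate G S)"
proof -
  define P where "P = rec_nat ({\<one>} \<union> S \<union> (\<lambda>x. inv x) ` S) (\<lambda>_ A. A <#> A)"
  have P0: "P 0 = {\<one>} \<union> S \<union> (\<lambda>x. inv x) ` S" and PS: "P (Suc n) = P n <#> P n" for n
    by (simp_all add: P_def)
  have nar: "left_narrow (P n)" for n
  proof (induction n)
    case 0
    then show ?case unfolding P0 by (intro left_narrow_Un S left_narrow_finite) auto
  next
    case (Suc n)
    then show ?case unfolding PS by (rule left_narrow_mult[OF _ Suc])
  qed
  have PG: "P n \<subseteq> carrier G" for n using nar by (simp add: left_narrow_def)
  have one: "\<one> \<in> P n" for n
  proof (induction n)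
    case (Suc n)
    have "\<one> = \<one> \<otimes> \<one>" by simp
    then show ?case unfolding PS set_mult_def using Suc by blast
  qed (simp add: P0)
  have mono: "P m \<subseteq> P n" if "m \<le> n" for m n
  proof (rule lift_Suc_mono_le[OF _ that])
    fix n show "P n \<subseteq> P (Suc n)"
    proof
      fix x assume x: "x \<in> P n"
      then have "x = \<one> \<otimes> x" using PG[of n] by auto
      then show "x \<in> P (Suc n)" unfolding PS set_mult_def using one[of n] x by blast
    qed
  qed
  have "x \<in> (\<Union>n. P n)" if "x \<in> generate G S" for x
    using that
  proof (induction rule: generate.induct)
    case one
    then show ?case using \<open>\<And>n. \<one> \<in> P n\<close> by blast
  next
    case (eng h1 h2)
    then obtain i j where "h1 \<in> P i" "h2 \<in> P j" by blast
    then have "h1 \<in> P (max i j)" "h2 \<in> P (max i j)" using mono by (meson max.cobounded1 max.cobounded2 subsetD)+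
    then have "h1 \<otimes> h2 \<in> P (Suc (max i j))" unfolding PS set_mult_def by blast
    then show ?case by blast
  qed (use P0 in auto)
  then have "generate G S \<subseteq> (\<Union>n. P n)" by blast
  then show ?thesis using left_narrow_mono left_narrow_UN[of UNIV P] nar by blast
qed

lemma normal_closure:
  assumes "H \<lhd> G"
  shows "T closure_of H \<lhd> G"
proof -
  interpret H: normal H G by fact
  have HG: "H \<subseteq> carrier G" by (rule H.subset)
  have cl: "H \<subseteq> T closure_of H" "T closure_of H \<subseteq> carrier G"
    using HG closure_of_subset[of H T] closure_of_subset_topspace[of T H] by (simp_all add: topspace_eq)
  show ?thesis
  proof (rule normal_invI)
    show "subgroup (T closure_of H) G"
    proof (rule subgroupI)
      show "T closure_of H \<noteq> {}" using cl H.one_closed by blast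
      show "inv a \<in> T closure_of H" if "a \<in> T closure_of H" for a
        using that HG by (intro closure_inv) auto
      show "a \<otimes> b \<in> T closure_of H" if "a \<in> T closure_of H" "b \<in> T closure_of H" for a b
        using that HG by (intro closure_mult) auto
    qed (rule cl)
    fix g h assume g: "g \<in> carrier G" and h: "h \<in> T closure_of H"
    have "continuous_map T T (\<lambda>x. g \<otimes> x \<otimes> inv g)"
      using continuous_map_compose[OF continuous_lmult[of g] continuous_rmult[of "inv g"]] g
      by (simp add: o_def)
    then have "(\<lambda>x. g \<otimes> x \<otimes> inv g) ` (T closure_of H) \<subseteq> T closure_of ((\<lambda>x. g \<otimes> x \<otimes> inv g) ` H)"
      by (rule continuous_map_image_closure_subset)
    also have "\<dots> \<subseteq> T closure_of H"
      by (rule closure_of_mono) (use g H.inv_op_closed2 in blast)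
    finally show "g \<otimes> h \<otimes> inv g \<in> T closure_of H" using h by blast
  qed
qed

lemma left_narrow_normal_hull:
  assumes S: "left_narrow S" "left_narrow ((\<lambda>x. inv x) ` S)"
    and conj: "\<And>s g. s \<in> S \<Longrightarrow> g \<in> carrier G \<Longrightarrow> g \<otimes> s \<otimes> inv g \<in> S"
  obtains H where "H \<lhd> G" "closedin T H" "left_narrow H" "S \<subseteq> H"
proof
  have SG: "S \<subseteq> carrier G" using S by (simp add: left_narrow_def)
  let ?H = "T closure_of (generate G S)"
  show "?H \<lhd> G" by (intro normal_closure normal_generateI SG conj)
  show "closedin T ?H" by simp
  show "left_narrow ?H" by (intro left_narrow_closure left_narrow_generate S)
  have "generate G S \<subseteq> ?H"
    by (intro closure_of_subset) (simp add: topspace_eq generate_incl SG)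
  then show "S \<subseteq> ?H" using generate.incl[of _ S G] by blast
qed

end

section \<open>Balanced chains of neighborhoods and their Cauchy sequences\<close>

text \<open>A sequence of neighborhoods that is a base of a group topology coarser than \<open>T\<close>, in
general not Hausdorff. The condition \<open>chain_conj\<close> is what \<open>\<omega>\<close>-balancedness
provides.\<close>

locale balanced_chain = topological_group +
  fixes U :: "nat \<Rightarrow> 'a set"
  assumes chain_nbhd: "nbhd (U n)"
    and chain_inv: "x \<in> U n \<Longrightarrow> inv x \<in> U n"
    and chain_cube: "x \<in> U (Suc n) \<Longrightarrow> y \<in> U (Suc n) \<Longrightarrow> z \<in> U (Suc n) \<Longrightarrow> x \<otimes> y \<otimes> z \<in> U n"
    and chain_conj: "g \<in> carrier G \<Longrightarrow> \<exists>m. \<forall>x\<in>U m. g \<otimes> x \<otimes> inv g \<in> U n"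
begin

lemma chain_closed [simp]: "x \<in> U n \<Longrightarrow> x \<in> carrier G"
  using chain_nbhd nbhd_subset by blast

lemma chain_one [simp]: "\<one> \<in> U n"
  using chain_nbhd nbhd_one by blast

lemma chain_mult: "x \<in> U (Suc n) \<Longrightarrow> y \<in> U (Suc n) \<Longrightarrow> x \<otimes> y \<in> U n"
  using chain_cube[of x n y \<one>] by simp

lemma chain_mono: "m \<le> n \<Longrightarrow> U n \<subseteq> U m"
proof (rule lift_Suc_antimono_le)
  show "U (Suc n) \<subseteq> U n" for n using chain_mult[of _ n \<one>] by auto
qed

lemma chain_conj_ge:
  assumes "g \<in> carrier G"
  obtains m where "n \<le> m" "\<And>x. x \<in> U m \<Longrightarrow> g \<otimes> x \<otimes> inv g \<in> U n"
proof -
  obtain m where "\<forall>x\<in>U m. g \<otimes> x \<otimes> inv g \<in> U n" using chain_conj assms by blast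
  then show thesis using that[of "max m n"] chain_mono[of m "max m n"] by (auto simp: subset_eq)
qed

definition small :: "nat \<Rightarrow> 'a set \<Rightarrow> bool" where
  "small n A \<longleftrightarrow> (\<forall>a\<in>A. \<forall>b\<in>A. inv a \<otimes> b \<in> U n \<and> a \<otimes> inv b \<in> U n)"

definition cauchy :: "(nat \<Rightarrow> 'a) \<Rightarrow> bool" where
  "cauchy p \<longleftrightarrow> range p \<subseteq> carrier G \<and> (\<forall>n. \<exists>N. small n (p ` {N..}))"

lemma cauchy_closed [simp]: "cauchy p \<Longrightarrow> p k \<in> carrier G"
  by (auto simp: cauchy_def)

lemma cauchyE:
  assumes "cauchy p"
  obtains N where "\<And>j k. N \<le> j \<Longrightarrow> N \<le> k \<Longrightarrow> inv (p j) \<otimes> p k \<in> U n"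
    "\<And>j k. N \<le> j \<Longrightarrow> N \<le> k \<Longrightarrow> p j \<otimes> inv (p k) \<in> U n"
proof -
  obtain N where "small n (p ` {N..})" using assms unfolding cauchy_def by blast
  then show thesis using that[of N] unfolding small_def by auto
qed

lemma cauchyI:
  assumes "\<And>k. p k \<in> carrier G"
    "\<And>n. \<exists>N. \<forall>j\<ge>N. \<forall>k\<ge>N. inv (p j) \<otimes> p k \<in> U n \<and> p j \<otimes> inv (p k) \<in> U n"
  shows "cauchy p"
  unfolding cauchy_def small_def
proof (intro conjI allI)
  fix n
  obtain N where "\<forall>j\<ge>N. \<forall>k\<ge>N. inv (p j) \<otimes> p k \<in> U n \<and> p j \<otimes> inv (p k) \<in> U n" using assms by blast
  then show "\<exists>N. \<forall>a\<in>p ` {N..}. \<forall>b\<in>p ` {N..}. inv a \<otimes> b \<in> U n \<and> a \<otimes> inv b \<in> U n"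
    by (intro exI[of _ N]) auto
qed (use assms in auto)

lemma cauchy_const: "x \<in> carrier G \<Longrightarrow> cauchy (\<lambda>_. x)"
  by (rule cauchyI) auto

lemma cauchy_inv: 
  assumes p: "cauchy p" shows "cauchy (\<lambda>k. inv (p k))"
proof (rule cauchyI)
  fix n
  obtain N where "\<And>j k. N \<le> j \<Longrightarrow> N \<le> k \<Longrightarrow> inv (p j) \<otimes> p k \<in> U n"
    "\<And>j k. N \<le> j \<Longrightarrow> N \<le> k \<Longrightarrow> p j \<otimes> inv (p k) \<in> U n" using cauchyE[OF p] by blast
  then show "\<exists>N. \<forall>j\<ge>N. \<forall>k\<ge>N. inv (inv (p j)) \<otimes> inv (p k) \<in> U n \<and> inv (p j) \<otimes> inv (inv (p k)) \<in> U n"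
    using p by (intro exI[of _ N]) auto
qed (use p in auto)

text \<open>The index \<open>m\<close> works for almost all members of the sequence at once: \<open>p
k\<close> differs from a fixed \<open>p N\<close> by a small left factor, and conjugation by small elements is
harmless. Right Cauchyness enters here, and this is why the Cauchy sequences have to be two-sided to form a
topological group.\<close>

lemma cauchy_conj:
  assumes p: "cauchy p"
  obtains m N where "\<And>k x. N \<le> k \<Longrightarrow> x \<in> U m \<Longrightarrow> p k \<otimes> x \<otimes> inv (p k) \<in> U n"
proof -
  obtain N where N: "\<And>j k. N \<le> j \<Longrightarrow> N \<le> k \<Longrightarrow> p j \<otimes> inv (p k) \<in> U (Suc n)"
    using cauchyE[OF p] by metis
  obtain m where m: "\<And>x. x \<in> U m \<Longrightarrow> p N \<otimes> x \<otimes> inv (p N) \<in> U (Suc n)"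
    using chain_conj_ge[of "p N" "Suc n"] p by (metis cauchy_closed)
  have "p k \<otimes> x \<otimes> inv (p k) \<in> U n" if "N \<le> k" "x \<in> U m" for k x
  proof -
    have "(p k \<otimes> inv (p N)) \<otimes> (p N \<otimes> x \<otimes> inv (p N)) \<otimes> inv (p k \<otimes> inv (p N)) \<in> U n"
      using N[of k N] m[of x] chain_inv that by (intro chain_cube[where n = n and z = "inv (p k \<otimes> inv (p N))"]) simp_all
    then show ?thesis using p that by (simp add: word_simps)
  qed
  then show thesis using that by blast
qed

lemma cauchy_mult:
  assumes p: "cauchy p" and q: "cauchy q" shows "cauchy (\<lambda>k. p k \<otimes> q k)"
proof (rule cauchyI)
  fix n
  obtain m1 N1 where 1: "\<And>k x. N1 \<le> k \<Longrightarrow> x \<in> U m1 \<Longrightarrow> p k \<otimes> x \<otimes> inv (p k) \<in> U (Suc n)"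
    using cauchy_conj[OF p] by blast
  obtain m2 N2 where 2: "\<And>k x. N2 \<le> k \<Longrightarrow> x \<in> U m2 \<Longrightarrow> inv (q k) \<otimes> x \<otimes> inv (inv (q k)) \<in> U (Suc n)"
    by (rule cauchy_conj[OF cauchy_inv[OF q], of "Suc n"]) blast
  obtain N3 where 3: "\<And>j k. N3 \<le> j \<Longrightarrow> N3 \<le> k \<Longrightarrow> inv (p j) \<otimes> p k \<in> U m2"
    using cauchyE[OF p] by metis
  obtain N4 where 4: "\<And>j k. N4 \<le> j \<Longrightarrow> N4 \<le> k \<Longrightarrow> p j \<otimes> inv (p k) \<in> U (Suc n)"
    using cauchyE[OF p] by metis
  obtain N5 where 5: "\<And>j k. N5 \<le> j \<Longrightarrow> N5 \<le> k \<Longrightarrow> inv (q j) \<otimes> q k \<in> U (Suc n)"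
    using cauchyE[OF q] by metis
  obtain N6 where 6: "\<And>j k. N6 \<le> j \<Longrightarrow> N6 \<le> k \<Longrightarrow> q j \<otimes> inv (q k) \<in> U m1"
    using cauchyE[OF q] by metis
  define N where "N = Max {N1, N2, N3, N4, N5, N6}"
  have N: "N1 \<le> N" "N2 \<le> N" "N3 \<le> N" "N4 \<le> N" "N5 \<le> N" "N6 \<le> N" by (auto simp: N_def)
  have "inv (p j \<otimes> q j) \<otimes> (p k \<otimes> q k) \<in> U n" if "N \<le> j" "N \<le> k" for j k
  proof -
    have "(inv (q j) \<otimes> (inv (p j) \<otimes> p k) \<otimes> inv (inv (q j))) \<otimes> (inv (q j) \<otimes> q k) \<in> U n"
      using N that by (intro chain_mult 2 3 5) auto
    then show ?thesis using p q by (simp add: word_simps)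
  qed
  moreover have "p j \<otimes> q j \<otimes> inv (p k \<otimes> q k) \<in> U n" if "N \<le> j" "N \<le> k" for j k
  proof -
    have "(p j \<otimes> (q j \<otimes> inv (q k)) \<otimes> inv (p j)) \<otimes> (p j \<otimes> inv (p k)) \<in> U n"
      using N that by (intro chain_mult 1 4 6) auto
    then show ?thesis using p q by (simp add: word_simps)
  qed
  ultimately show "\<exists>N. \<forall>j\<ge>N. \<forall>k\<ge>N. inv (p j \<otimes> q j) \<otimes> (p k \<otimes> q k) \<in> U n \<and> p j \<otimes> q j \<otimes> inv (p k \<otimes> q k) \<in> U n"
    by blast
qed (use p q in auto)

text \<open>Modulo the sequences that converge to the unit, this is the Raikov completion of the Hausdorff
quotient of the group for the chain topology.\<close>

definition cauchy_group :: "(nat \<Rightarrow> 'a) monoid" where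
  "cauchy_group = \<lparr>carrier = {p. cauchy p}, mult = (\<lambda>p q k. p k \<otimes> q k), one = (\<lambda>_. \<one>)\<rparr>"

lemma cauchy_group_simps [simp]:
  "p \<in> carrier cauchy_group \<longleftrightarrow> cauchy p"
  "p \<otimes>\<^bsub>cauchy_group\<^esub> q = (\<lambda>k. p k \<otimes> q k)"
  "\<one>\<^bsub>cauchy_group\<^esub> = (\<lambda>_. \<one>)"
  by (simp_all add: cauchy_group_def)

lemma group_cauchy_group: "group cauchy_group"
proof (rule groupI)
  show "\<exists>y\<in>carrier cauchy_group. y \<otimes>\<^bsub>cauchy_group\<^esub> x = \<one>\<^bsub>cauchy_group\<^esub>"
    if "x \<in> carrier cauchy_group" for x
    using that cauchy_inv by (intro bexI[of _ "\<lambda>k. inv (x k)"]) auto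
qed (auto simp: m_assoc intro: cauchy_mult cauchy_const)

lemma inv_cauchy_group [simp]:
  "cauchy p \<Longrightarrow> inv\<^bsub>cauchy_group\<^esub> p = (\<lambda>k. inv (p k))"
  by (rule group.inv_equality[OF group_cauchy_group]) (auto intro: cauchy_inv)

definition tail_in :: "nat \<Rightarrow> (nat \<Rightarrow> 'a) set" where
  "tail_in n = {p. cauchy p \<and> (\<forall>\<^sub>F k in sequentially. p k \<in> U n)}"

lemma tail_filter_base: "unit_filter_base cauchy_group (range tail_in)"
proof (intro unit_filter_base.intro group_cauchy_group unit_filter_base_axioms.intro)
  fix B B' assume "B \<in> range tail_in" "B' \<in> range tail_in"
  then obtain m n where mn: "B = tail_in m" "B' = tail_in n" by blast
  have "tail_in (max m n) \<subseteq> B \<inter> B'"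
    unfolding mn tail_in_def using chain_mono[of m "max m n"] chain_mono[of n "max m n"]
    by (auto elim: eventually_mono)
  then show "\<exists>C\<in>range tail_in. C \<subseteq> B \<inter> B'" by blast
next
  fix B assume "B \<in> range tail_in"
  then obtain n where B: "B = tail_in n" by blast
  show "B \<subseteq> carrier cauchy_group" "\<one>\<^bsub>cauchy_group\<^esub> \<in> B"
    unfolding B tail_in_def using cauchy_const by auto
  have "p \<otimes>\<^bsub>cauchy_group\<^esub> q \<in> B" if "p \<in> tail_in (Suc n)" "q \<in> tail_in (Suc n)" for p q
    using that unfolding B tail_in_def by (auto intro: cauchy_mult chain_mult elim: eventually_elim2)
  then show "\<exists>C\<in>range tail_in. \<forall>p\<in>C. \<forall>q\<in>C. p \<otimes>\<^bsub>cauchy_group\<^esub> q \<in> B" by blast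
  have "inv\<^bsub>cauchy_group\<^esub> p \<in> B" if "p \<in> tail_in n" for p
    using that unfolding B tail_in_def by (auto intro: cauchy_inv elim!: eventually_mono chain_inv)
  then show "\<exists>C\<in>range tail_in. \<forall>p\<in>C. inv\<^bsub>cauchy_group\<^esub> p \<in> B" by blast
  fix g assume "g \<in> carrier cauchy_group"
  then have g: "cauchy g" by simp
  obtain m N where N: "\<And>k x. N \<le> k \<Longrightarrow> x \<in> U m \<Longrightarrow> g k \<otimes> x \<otimes> inv (g k) \<in> U n"
    using cauchy_conj[OF g] by blast
  have "g \<otimes>\<^bsub>cauchy_group\<^esub> p \<otimes>\<^bsub>cauchy_group\<^esub> inv\<^bsub>cauchy_group\<^esub> g \<in> B" if p: "p \<in> tail_in m" for p
  proof -
    have "\<forall>\<^sub>F k in sequentially. g k \<otimes> p k \<otimes> inv (g k) \<in> U n"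
    proof (rule eventually_elim2)
      show "\<forall>\<^sub>F k in sequentially. p k \<in> U m" using p by (simp add: tail_in_def)
      show "\<forall>\<^sub>F k in sequentially. N \<le> k" by (rule eventually_ge_at_top)
    qed (rule N)
    then show ?thesis
      using p g unfolding B tail_in_def by (auto intro!: cauchy_mult cauchy_inv)
  qed
  then show "\<exists>C\<in>range tail_in. \<forall>p\<in>C. g \<otimes>\<^bsub>cauchy_group\<^esub> p \<otimes>\<^bsub>cauchy_group\<^esub> inv\<^bsub>cauchy_group\<^esub> g \<in> B"
    by blast
qed auto

end

text \<open>Choose countably many witnesses \<open>v A i\<close> of \<open>\<omega>\<close>-balancedness for
every neighborhood \<open>A\<close>, and let \<open>U (n + 1)\<close> be so small that it lies in \<open>v A
0, \<dots>, v A n\<close> for each \<open>A\<close> among \<open>U 0, \<dots>, U n\<close>. Every witness of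
every member is then handled at some stage.\<close>

lemma (in topological_group) balanced_chain_exists:
  assumes bal: "omega_balanced G T" and W: "nbhd W"
  obtains U where "balanced_chain G T U" "U 0 \<subseteq> W"
proof -
  have "\<exists>v. (\<forall>i::nat. nbhd (v i)) \<and> (\<forall>g\<in>carrier G. \<exists>i. \<forall>x\<in>v i. g \<otimes> x \<otimes> inv g \<in> A)" if "nbhd A" for A
  proof -
    obtain \<V> where V: "countable \<V>" "\<forall>V\<in>\<V>. nbhd V"
      "\<forall>x\<in>carrier G. \<exists>V\<in>\<V>. (x <# V) #> inv x \<subseteq> A"
      using bal \<open>nbhd A\<close> unfolding omega_balanced_def by meson
    have "\<V> \<noteq> {}" using V(3) by auto
    then have rng: "range (from_nat_into \<V>) = \<V>" using V(1) by (rule range_from_nat_into)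
    have "\<exists>i. \<forall>x\<in>from_nat_into \<V> i. g \<otimes> x \<otimes> inv g \<in> A" if g: "g \<in> carrier G" for g
    proof -
      obtain V where "V \<in> \<V>" "(g <# V) #> inv g \<subseteq> A" using V(3) g by blast
      moreover obtain i where "V = from_nat_into \<V> i" using rng \<open>V \<in> \<V>\<close> by (metis rangeE)
      ultimately show ?thesis by (intro exI[of _ i]) (auto simp: l_coset_def r_coset_def)
    qed
    moreover have "nbhd (from_nat_into \<V> i)" for i
      using V(2) rng by (metis rangeI)
    ultimately show ?thesis by blast
  qed
  then obtain v where v: "\<And>A i. nbhd A \<Longrightarrow> nbhd (v A i)"
    "\<And>A g. nbhd A \<Longrightarrow> g \<in> carrier G \<Longrightarrow> \<exists>i::nat. \<forall>x\<in>v A i. g \<otimes> x \<otimes> inv g \<in> A"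
    by metis
  define root where "root A = (SOME V. nbhd V \<and> V \<subseteq> A \<and> (\<forall>x\<in>V. inv x \<in> V) \<and>
      (\<forall>x\<in>V. \<forall>y\<in>V. \<forall>z\<in>V. x \<otimes> y \<otimes> z \<in> A))" for A
  have root: "nbhd (root A) \<and> root A \<subseteq> A \<and> (\<forall>x\<in>root A. inv x \<in> root A) \<and>
      (\<forall>x\<in>root A. \<forall>y\<in>root A. \<forall>z\<in>root A. x \<otimes> y \<otimes> z \<in> A)" if "nbhd A" for A
    unfolding root_def
  proof (rule someI_ex)
    show "\<exists>V. nbhd V \<and> V \<subseteq> A \<and> (\<forall>x\<in>V. inv x \<in> V) \<and> (\<forall>x\<in>V. \<forall>y\<in>V. \<forall>z\<in>V. x \<otimes> y \<otimes> z \<in> A)"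
      using nbhd_symmetric_cubeE[OF that] by metis
  qed
  define step where "step h n = root (\<Inter>(set h \<union> (\<Union>A\<in>set h. v A ` {..n})))" for h n
  \<comment> \<open>The list \<open>hist n\<close> is \<open>[U n, \<dots>, U 0]\<close>: the recursion needs all earlier members.\<close>
  define hist where "hist = rec_nat [root W] (\<lambda>n h. step h n # h)"
  define U where "U n = hd (hist n)" for n
  have hist0: "hist 0 = [root W]" and histS: "hist (Suc n) = step (hist n) n # hist n" for n
    by (simp_all add: hist_def)
  have U0: "U 0 = root W" and US: "U (Suc n) = step (hist n) n" for n
    by (simp_all add: U_def hist0 histS)
  have nbhd_Inter: "nbhd (\<Inter>\<A>)" if "finite \<A>" "\<A> \<noteq> {}" "\<And>A. A \<in> \<A> \<Longrightarrow> nbhd A" for \<A>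
    using that by (induction rule: finite_ne_induct) (auto intro: nbhd_Int)
  have hist_nbhd: "hist n \<noteq> [] \<and> (\<forall>A\<in>set (hist n). nbhd A)" for n
  proof (induction n)
    case 0
    then show ?case using root W by (simp add: hist0)
  next
    case (Suc n)
    have "nbhd (step (hist n) n)"
      unfolding step_def using Suc v(1) by (intro root[THEN conjunct1] nbhd_Inter) auto
    then show ?case using Suc by (simp add: histS)
  qed
  let ?M = "\<lambda>n. \<Inter>(set (hist n) \<union> (\<Union>A\<in>set (hist n). v A ` {..n}))"
  have M: "nbhd (?M n)" for n
    using hist_nbhd[of n] v(1) by (intro nbhd_Inter) auto
  have inhist: "U m \<in> set (hist n)" if "m \<le> n" for m n
    using that
  proof (induction n)
    case (Suc n)
    then show ?case by (cases "m = Suc n") (auto simp: histS US)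
  qed (simp add: U0 hist0)
  have "balanced_chain G T U"
  proof unfold_locales
    show U_nbhd: "nbhd (U n)" for n using inhist[of n n] hist_nbhd by blast
    show "inv x \<in> U n" if "x \<in> U n" for x n
      using that root[OF W] root[OF M] by (cases n) (auto simp: U0 US step_def)
    show "x \<otimes> y \<otimes> z \<in> U n" if "x \<in> U (Suc n)" "y \<in> U (Suc n)" "z \<in> U (Suc n)" for x y z n
    proof -
      have "x \<otimes> y \<otimes> z \<in> ?M n" using that root[OF M[of n]] unfolding US step_def by blast
      then show ?thesis using inhist[of n n] by blast
    qed
    show "\<exists>m. \<forall>x\<in>U m. g \<otimes> x \<otimes> inv g \<in> U n" if g: "g \<in> carrier G" for g n
    proof -
      obtain i where i: "\<forall>x\<in>v (U n) i. g \<otimes> x \<otimes> inv g \<in> U n" using v(2) U_nbhd g by blast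
      have "U (Suc (max n i)) \<subseteq> ?M (max n i)" using root[OF M] unfolding US step_def by blast
      also have "\<dots> \<subseteq> v (U n) i"
        using inhist[of n "max n i"]
        by (intro Inter_lower UnI2 UN_I[of "U n"] imageI) (auto simp: max.coboundedI2)
      finally show ?thesis using i by blast
    qed
  qed
  moreover have "U 0 \<subseteq> W" using root[OF W] by (simp add: U0)
  ultimately show thesis using that by blast
qed

section \<open>Completeness over a coarser compact topology\<close>

lemma (in unit_filter_base) saturated_filter_base:
  assumes "H \<lhd> G"
  shows "unit_filter_base G ((\<lambda>B. B <#> H) ` \<B>)"
proof -
  interpret H: normal H G by fact
  have satI: "b \<otimes> h \<in> B <#> H" if "b \<in> B" "h \<in> H" for B b h using that by (auto simp: set_mult_def)
  have satE: "\<exists>b\<in>B. \<exists>h\<in>H. x = b \<otimes> h" if "x \<in> B <#> H" for B x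
    using that by (auto simp: set_mult_def)
  show ?thesis
  proof (intro unit_filter_base.intro is_group unit_filter_base_axioms.intro)
    show "(\<lambda>B. B <#> H) ` \<B> \<noteq> {}" using nonempty by blast
  next
    fix P Q assume "P \<in> (\<lambda>B. B <#> H) ` \<B>" "Q \<in> (\<lambda>B. B <#> H) ` \<B>"
    then obtain A B where AB: "A \<in> \<B>" "P = A <#> H" "B \<in> \<B>" "Q = B <#> H" by blast
    then obtain C where "C \<in> \<B>" "C \<subseteq> A \<inter> B" using base_directed by blast
    then show "\<exists>R\<in>(\<lambda>B. B <#> H) ` \<B>. R \<subseteq> P \<inter> Q"
      using AB by (intro bexI[of _ "C <#> H"]) (auto simp: set_mult_def)
  next
    fix P assume "P \<in> (\<lambda>B. B <#> H) ` \<B>"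
    then obtain B where B: "B \<in> \<B>" "P = B <#> H" by blast
    show "P \<subseteq> carrier G" unfolding B(2) by (intro set_mult_closed base_subset B H.subset)
    show "\<one> \<in> P" using satI[OF base_one[OF B(1)] H.one_closed] B by simp
    show "\<exists>Q\<in>(\<lambda>B. B <#> H) ` \<B>. \<forall>x\<in>Q. \<forall>y\<in>Q. x \<otimes> y \<in> P"
    proof -
      obtain C where C: "C \<in> \<B>" "\<forall>x\<in>C. \<forall>y\<in>C. x \<otimes> y \<in> B" using base_mult B by blast
      have "x \<otimes> y \<in> P" if xy: "x \<in> C <#> H" "y \<in> C <#> H" for x y
      proof -
        obtain b h b' h' where *: "b \<in> C" "h \<in> H" "x = b \<otimes> h" "b' \<in> C" "h' \<in> H" "y = b' \<otimes> h'"
          using satE[OF xy(1)] satE[OF xy(2)] by blast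
        have car: "b \<in> carrier G" "b' \<in> carrier G" "h \<in> carrier G" "h' \<in> carrier G"
          using * C(1) base_subset H.subset by blast+
        have "(b \<otimes> b') \<otimes> ((inv b' \<otimes> h \<otimes> b') \<otimes> h') \<in> P"
          unfolding B(2) using * C(2) car by (intro satI H.m_closed H.inv_op_closed1) auto
        then show ?thesis using car * by (simp add: word_simps)
      qed
      then show ?thesis using C(1) by blast
    qed
    show "\<exists>Q\<in>(\<lambda>B. B <#> H) ` \<B>. \<forall>x\<in>Q. inv x \<in> P"
    proof -
      obtain C where C: "C \<in> \<B>" "\<forall>x\<in>C. inv x \<in> B" using base_inv B by blast
      have "inv x \<in> P" if xy: "x \<in> C <#> H" for x
      proof -
        obtain b h where *: "b \<in> C" "h \<in> H" "x = b \<otimes> h" using satE[OF xy(1)] by blast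
        have car: "b \<in> carrier G" "h \<in> carrier G" using * C(1) base_subset H.subset by blast+
        have "inv b \<otimes> (b \<otimes> inv h \<otimes> inv b) \<in> P"
          unfolding B(2) using * C(2) car by (intro satI H.inv_op_closed2 H.m_inv_closed) auto
        then show ?thesis using car * by (simp add: word_simps)
      qed
      then show ?thesis using C(1) by blast
    qed
    fix g assume g: "g \<in> carrier G"
    obtain C where C: "C \<in> \<B>" "\<forall>x\<in>C. g \<otimes> x \<otimes> inv g \<in> B" using base_conj B g by blast
    have "g \<otimes> x \<otimes> inv g \<in> P" if xy: "x \<in> C <#> H" for x
    proof -
      obtain b h where *: "b \<in> C" "h \<in> H" "x = b \<otimes> h" using satE[OF xy(1)] by blast
      have car: "b \<in> carrier G" "h \<in> carrier G" using * C(1) base_subset H.subset by blast+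
      have "(g \<otimes> b \<otimes> inv g) \<otimes> (g \<otimes> h \<otimes> inv g) \<in> P"
        unfolding B(2) using * C(2) car g by (intro satI H.inv_op_closed2) auto
      then show ?thesis using car * g by (simp add: word_simps)
    qed
    then show "\<exists>Q\<in>(\<lambda>B. B <#> H) ` \<B>. \<forall>x\<in>Q. g \<otimes> x \<otimes> inv g \<in> P" using C(1) by blast
  qed
qed

text \<open>The situation of the theorem after the compact group has been pulled back to
\<open>G\<close>.\<close>

locale iTG_closed_over_compact = topological_group G T + coarse: topological_group G K
  for G :: "('a, 'm) monoid_scheme" (structure) and T K :: "'a topology" +
  assumes compact: "compact_space K"
    and coarser: "openin K W \<Longrightarrow> openin T W"
    and iTG_closed: "iTG_closed TYPE('a set set) G T"
begin

lemma nbhd_coarse: "coarse.nbhd W \<Longrightarrow> nbhd W"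
  unfolding unit_nbhd_def using coarser topspace_eq coarse.topspace_eq by auto

text \<open>Map \<open>x\<close> to \<open>(x, x H)\<close> in \<open>(G, K) \<times> (G, T) / H\<close>. If
\<open>q\<close> is in the \<open>K\<close>-closure of \<open>H\<close>, then \<open>(q, H)\<close> is in the
closure of the image, so it is in the image, which means \<open>q \<in> H\<close>. The quotient by
\<open>H\<close> is obtained from the neighborhood base of the sets \<open>U H\<close>.\<close>

lemma normal_closedin_coarse:
  assumes H: "H \<lhd> G" and clo: "closedin T H"
  shows "closedin K H"
proof -
  interpret H: normal H G by fact
  have "q \<in> H" if q: "q \<in> K closure_of H" for q
  proof -
    let ?\<B> = "{A \<times> B | A B. A \<in> {W. coarse.nbhd W} \<and> B \<in> (\<lambda>U. U <#> H) ` {U. nbhd U}}"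
    have qG: "q \<in> carrier G" and qH: "\<And>W. coarse.nbhd W \<Longrightarrow> \<exists>w\<in>W. q \<otimes> w \<in> H"
      using q unfolding coarse.in_closure_iff_nbhd by blast+
    have invq: "inv\<^bsub>G \<times>\<times> G\<^esub> (q, \<one>) = (inv q, \<one>)" using qG by (simp add: inv_DirProd)
    have "\<exists>x\<in>carrier G. \<forall>B\<in>?\<B>. inv\<^bsub>G \<times>\<times> G\<^esub> (q, \<one>) \<otimes>\<^bsub>G \<times>\<times> G\<^esub> (x, x) \<in> B"
    proof (rule iTG_closed_absorbs_limits[where \<phi> = "\<lambda>x. (x, x)" and \<B> = ?\<B> and \<Gamma> = "G \<times>\<times> G" and g = "(q, \<one>)"])
      show "topological_group G T" by (rule topological_group_axioms)
      show "iTG_closed TYPE('a set set) G T" by (rule iTG_closed)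
      show "unit_filter_base (G \<times>\<times> G) ?\<B>"
        by (intro unit_filter_base_DirProd coarse.unit_nbhd_filter_base
            unit_filter_base.saturated_filter_base unit_nbhd_filter_base H)
      show "(\<lambda>x. (x, x)) \<in> hom G (G \<times>\<times> G)" by (simp add: hom_def)
      show "\<exists>U. nbhd U \<and> (\<lambda>x. (x, x)) ` U \<subseteq> B" if "B \<in> ?\<B>" for B
      proof -
        obtain W U where WU: "B = W \<times> (U <#> H)" "coarse.nbhd W" "nbhd U" using \<open>B \<in> ?\<B>\<close> by blast
        have "u \<in> U <#> H" if "u \<in> U" for u
        proof -
          have "u \<otimes> \<one> \<in> U <#> H" using that H.one_closed unfolding set_mult_def by blast
          then show ?thesis using that nbhd_subset[OF WU(3)] by (simp add: subset_eq)
        qed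
        then show ?thesis
          using WU nbhd_Int[OF nbhd_coarse[OF WU(2)] WU(3)] by (intro exI[of _ "W \<inter> U"]) auto
      qed
      show "x = \<one>" if "x \<in> carrier G" "\<And>B. B \<in> ?\<B> \<Longrightarrow> (x, x) \<in> B" for x
      proof (rule coarse.nbhd_Inter_trivial)
        fix W assume "coarse.nbhd W"
        then have "W \<times> (carrier G <#> H) \<in> ?\<B>" using nbhd_carrier by blast
        from that(2)[OF this] show "x \<in> W" by simp
      qed (rule that)
      show "(q, \<one>) \<in> carrier (G \<times>\<times> G)" using qG by simp
      show "\<exists>x\<in>carrier G. inv\<^bsub>G \<times>\<times> G\<^esub> (q, \<one>) \<otimes>\<^bsub>G \<times>\<times> G\<^esub> (x, x) \<in> B" if "B \<in> ?\<B>" for B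
      proof -
        obtain W U where WU: "B = W \<times> (U <#> H)" "coarse.nbhd W" "nbhd U" using \<open>B \<in> ?\<B>\<close> by blast
        obtain w where w: "w \<in> W" "q \<otimes> w \<in> H" using qH[OF WU(2)] by blast
        have wG: "w \<in> carrier G" using w coarse.nbhd_subset[OF WU(2)] by blast
        have "\<one> \<otimes> (q \<otimes> w) \<in> U <#> H" using nbhd_one[OF WU(3)] w unfolding set_mult_def by blast
        then show ?thesis using w qG wG WU(1) by (intro bexI[of _ "q \<otimes> w"]) (auto simp: invq)
      qed
    qed
    then obtain x where x: "x \<in> carrier G"
      and limit: "\<forall>B\<in>?\<B>. inv\<^bsub>G \<times>\<times> G\<^esub> (q, \<one>) \<otimes>\<^bsub>G \<times>\<times> G\<^esub> (x, x) \<in> B"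
      by (elim bexE) rule
    have "inv q \<otimes> x = \<one>"
    proof (rule coarse.nbhd_Inter_trivial)
      fix W assume "coarse.nbhd W"
      then have "W \<times> (carrier G <#> H) \<in> ?\<B>" using nbhd_carrier by blast
      from bspec[OF limit this] show "inv q \<otimes> x \<in> W" by (simp add: invq)
    qed (use qG x in simp)
    then have xq: "x = q" using qG x by (metis inv_mult_cancel(2) r_one)
    have "inv x \<in> T closure_of H"
      unfolding in_closure_iff_nbhd
    proof (intro conjI allI impI)
      fix U assume U: "nbhd U"
      then have "carrier G \<times> (U <#> H) \<in> ?\<B>" using coarse.nbhd_carrier by blast
      from bspec[OF limit this] have "x \<in> U <#> H" using x by (simp add: invq)
      then obtain u h where uh: "u \<in> U" "h \<in> H" "x = u \<otimes> h" by (auto simp: set_mult_def)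
      have "u \<in> carrier G" "h \<in> carrier G" using uh nbhd_subset[OF U] H.subset by blast+
      then have "inv x \<otimes> u = inv h" using uh by (simp add: word_simps)
      then show "\<exists>u\<in>U. inv x \<otimes> u \<in> H" using uh by (intro bexI[of _ u]) simp_all
    qed (use x in simp)
    then have "inv x \<in> H" using clo by (simp add: closure_of_closedin)
    then have "inv (inv x) \<in> H" by blast
    then show ?thesis using xq x by simp
  qed
  moreover have "H \<subseteq> K closure_of H" using H.subset by (simp add: closure_of_subset coarse.topspace_eq)
  ultimately have "K closure_of H = H" by blast
  then show ?thesis by (metis closedin_closure_of)
qed

text \<open>Map \<open>x\<close> to the pair of \<open>x\<close> and the constant sequence \<open>x\<close> in
\<open>(G, K) \<times> C\<close> with \<open>C\<close> the group of Cauchy sequences. The assumption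
\<open>approx\<close> says that \<open>(q, p)\<close> is in the closure of the image. The point of the image
that it equals can only be \<open>(q, q)\<close>, as \<open>K\<close> is Hausdorff, so \<open>p\<close> and
the constant sequence \<open>q\<close> have the same limit.\<close>

lemma cauchy_converges:
  assumes chain: "balanced_chain G T U" and p: "balanced_chain.cauchy G U p" and q: "q \<in> carrier G"
    and approx: "\<And>W n. coarse.nbhd W \<Longrightarrow>
      \<exists>x\<in>carrier G. inv q \<otimes> x \<in> W \<and> (\<forall>\<^sub>F k in sequentially. inv (p k) \<otimes> x \<in> U n)"
  shows "\<forall>\<^sub>F k in sequentially. inv (p k) \<otimes> q \<in> U n"
proof -
  interpret balanced_chain G T U by fact
  let ?C = cauchy_group
  let ?\<B> = "{A \<times> B | A B. A \<in> {W. coarse.nbhd W} \<and> B \<in> range tail_in}"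
  have inv: "inv\<^bsub>G \<times>\<times> ?C\<^esub> (q, p) = (inv q, \<lambda>k. inv (p k))"
    using q p group_cauchy_group by (simp add: inv_DirProd)
  have tail: "(\<lambda>k. inv (p k) \<otimes> x) \<in> tail_in n \<longleftrightarrow> (\<forall>\<^sub>F k in sequentially. inv (p k) \<otimes> x \<in> U n)"
    if "x \<in> carrier G" for x n
    using cauchy_mult[OF cauchy_inv[OF p] cauchy_const[OF that]] by (simp add: tail_in_def)
  have "\<exists>x\<in>carrier G. \<forall>B\<in>?\<B>. inv\<^bsub>G \<times>\<times> ?C\<^esub> (q, p) \<otimes>\<^bsub>G \<times>\<times> ?C\<^esub> (x, \<lambda>_. x) \<in> B"
  proof (rule iTG_closed_absorbs_limits[where \<phi> = "\<lambda>x. (x, \<lambda>_. x)" and \<B> = ?\<B> and \<Gamma> = "G \<times>\<times> ?C" and g = "(q, p)"])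
    show "topological_group G T" by (rule topological_group_axioms)
    show "iTG_closed TYPE('a set set) G T" by (rule iTG_closed)
    show "unit_filter_base (G \<times>\<times> ?C) ?\<B>"
      by (intro unit_filter_base_DirProd coarse.unit_nbhd_filter_base tail_filter_base)
    show "(\<lambda>x. (x, \<lambda>_. x)) \<in> hom G (G \<times>\<times> ?C)" using cauchy_const by (simp add: hom_def)
    show "\<exists>V. nbhd V \<and> (\<lambda>x. (x, \<lambda>_. x)) ` V \<subseteq> B" if "B \<in> ?\<B>" for B
    proof -
      obtain W n where Wn: "B = W \<times> tail_in n" "coarse.nbhd W" using \<open>B \<in> ?\<B>\<close> by blast
      then show ?thesis
        using nbhd_Int[OF nbhd_coarse[OF Wn(2)] chain_nbhd[of n]] cauchy_const
        by (intro exI[of _ "W \<inter> U n"]) (auto simp: tail_in_def)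
    qed
    show "x = \<one>" if "x \<in> carrier G" "\<And>B. B \<in> ?\<B> \<Longrightarrow> (x, \<lambda>_. x) \<in> B" for x
    proof (rule coarse.nbhd_Inter_trivial)
      fix W assume "coarse.nbhd W"
      then have "W \<times> tail_in 0 \<in> ?\<B>" by blast
      from that(2)[OF this] show "x \<in> W" by simp
    qed (rule that)
    show "(q, p) \<in> carrier (G \<times>\<times> ?C)" using q p by simp
    show "\<exists>x\<in>carrier G. inv\<^bsub>G \<times>\<times> ?C\<^esub> (q, p) \<otimes>\<^bsub>G \<times>\<times> ?C\<^esub> (x, \<lambda>_. x) \<in> B" if "B \<in> ?\<B>" for B
    proof -
      obtain W n where Wn: "B = W \<times> tail_in n" "coarse.nbhd W" using \<open>B \<in> ?\<B>\<close> by blast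
      then obtain x where "x \<in> carrier G" "inv q \<otimes> x \<in> W" "\<forall>\<^sub>F k in sequentially. inv (p k) \<otimes> x \<in> U n"
        using approx by blast
      then show ?thesis using Wn(1) by (intro bexI[of _ x]) (simp_all add: inv tail)
    qed
  qed
  then obtain x where x: "x \<in> carrier G"
    and limit: "\<forall>B\<in>?\<B>. inv\<^bsub>G \<times>\<times> ?C\<^esub> (q, p) \<otimes>\<^bsub>G \<times>\<times> ?C\<^esub> (x, \<lambda>_. x) \<in> B"
    by (elim bexE) rule
  have "inv q \<otimes> x = \<one>"
  proof (rule coarse.nbhd_Inter_trivial)
    fix W assume "coarse.nbhd W"
    then have "W \<times> tail_in 0 \<in> ?\<B>" by blast
    from bspec[OF limit this] show "inv q \<otimes> x \<in> W" by (simp add: inv)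
  qed (use q x in simp)
  then have xq: "x = q" using q x by (metis inv_mult_cancel(2) r_one)
  have "carrier G \<times> tail_in n \<in> ?\<B>" using coarse.nbhd_carrier by blast
  from bspec[OF limit this] show ?thesis unfolding xq using q by (simp add: inv tail)
qed

end

section \<open>Closed normal narrow subgroups: almost openness\<close>

context topological_group
begin

lemma closure_ldiv:
  assumes x: "x \<in> T closure_of A" and y: "y \<in> T closure_of A"
    and D: "\<And>a b. a \<in> A \<Longrightarrow> b \<in> A \<Longrightarrow> inv a \<otimes> b \<in> D"
  shows "inv x \<otimes> y \<in> T closure_of D"
proof -
  have "continuous_map (prod_topology T T) (prod_topology T T) (\<lambda>(x, y). (inv x, id y))"
    using continuous_inv by (simp add: continuous_map_prod_top)
  from continuous_map_compose[OF this continuous_mult]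
  have "continuous_map (prod_topology T T) T (\<lambda>(x, y). inv x \<otimes> y)"
    by (simp add: o_def case_prod_unfold)
  then have "(\<lambda>(x, y). inv x \<otimes> y) ` (prod_topology T T closure_of (A \<times> A))
      \<subseteq> T closure_of ((\<lambda>(x, y). inv x \<otimes> y) ` (A \<times> A))"
    by (rule continuous_map_image_closure_subset)
  moreover have "T closure_of ((\<lambda>(x, y). inv x \<otimes> y) ` (A \<times> A)) \<subseteq> T closure_of D"
    by (rule closure_of_mono) (use D in auto)
  moreover have "(x, y) \<in> prod_topology T T closure_of (A \<times> A)"
    using x y by (simp add: closure_of_Times)
  ultimately show ?thesis by (metis (mono_tags, lifting) case_prod_conv image_eqI subset_eq)
qed

text \<open>A narrow set can be covered by countably many small translates with centers in the set itself:
replace every center of a slightly finer cover by a point of the set nearby.\<close>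

lemma left_narrow_centers_in:
  assumes A: "left_narrow A" and U: "nbhd U"
  obtains D where "countable D" "D \<subseteq> A" "\<And>a. a \<in> A \<Longrightarrow> \<exists>d\<in>D. inv d \<otimes> a \<in> U"
proof -
  have AG: "A \<subseteq> carrier G" using A by (simp add: left_narrow_def)
  obtain V where V: "nbhd V" "\<And>x. x \<in> V \<Longrightarrow> inv x \<in> V"
    "\<And>x y z. x \<in> V \<Longrightarrow> y \<in> V \<Longrightarrow> z \<in> V \<Longrightarrow> x \<otimes> y \<otimes> z \<in> U"
    using nbhd_symmetric_cubeE[OF U] by metis
  obtain C where C: "countable C" "C \<subseteq> carrier G" "\<forall>a\<in>A. \<exists>c\<in>C. inv c \<otimes> a \<in> V"
    using A V(1) unfolding left_narrow_def by meson
  define pick where "pick c = (SOME a. a \<in> A \<and> inv c \<otimes> a \<in> V)" for c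
  define D where "D = pick ` {c \<in> C. \<exists>a\<in>A. inv c \<otimes> a \<in> V}"
  have pick: "pick c \<in> A \<and> inv c \<otimes> pick c \<in> V" if "\<exists>a\<in>A. inv c \<otimes> a \<in> V" for c
    unfolding pick_def by (rule someI_ex) (use that in blast)
  show thesis
  proof
    show "countable D" unfolding D_def using C(1) by auto
    show "D \<subseteq> A" unfolding D_def using pick by blast
    fix a assume a: "a \<in> A"
    then obtain c where c: "c \<in> C" "inv c \<otimes> a \<in> V" using C by blast
    have p: "pick c \<in> A" "inv c \<otimes> pick c \<in> V" using pick a c by blast+
    have car: "a \<in> carrier G" "c \<in> carrier G" "pick c \<in> carrier G" using a c p AG C(2) by blast+
    have "inv (inv c \<otimes> pick c) \<otimes> (inv c \<otimes> a) \<otimes> \<one> \<in> U"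
      using V(2,3) c p nbhd_one[OF V(1)] by blast
    then have "inv (pick c) \<otimes> a \<in> U" using car by (simp add: word_simps)
    then show "\<exists>d\<in>D. inv d \<otimes> a \<in> U" using a c by (auto simp: D_def)
  qed
qed

end

locale narrow_normal_subgroup = iTG_closed_over_compact +
  fixes H
  assumes H_normal: "H \<lhd> G" and H_closed: "closedin T H" and H_narrow: "left_narrow H"
begin

sublocale H: normal H G by (rule H_normal)

abbreviation KH :: "'a topology" where "KH \<equiv> subtopology K H"

lemma H_closed_coarse: "closedin K H"
  using normal_closedin_coarse H_normal H_closed .

lemma H_carrier [simp]: "x \<in> H \<Longrightarrow> x \<in> carrier G"
  using H.subset by blast

lemma H_topspace [simp]: "x \<in> H \<Longrightarrow> x \<in> topspace K"
  by (simp add: coarse.topspace_eq)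

lemma topspace_KH: "topspace KH = H"
  by auto

lemma compact_KH: "compact_space KH"
  using compact H_closed_coarse by (simp add: closedin_compact_space compact_space_subtopology)

lemma Baire_KH:
  assumes "countable \<F>" "\<And>F. F \<in> \<F> \<Longrightarrow> closedin KH F \<and> KH interior_of F = {}"
  shows "KH interior_of \<Union>\<F> = {}"
proof (rule Baire_category_alt[OF disjI2 assms])
  have "Hausdorff_space KH" using coarse.Hausdorff by (rule Hausdorff_space_subtopology)
  then show "locally_compact_space KH \<and> regular_space KH"
    using compact_KH by (simp add: compact_imp_locally_compact_space compact_Hausdorff_imp_regular_space)
qed

lemma lmult_KH: "h \<in> H \<Longrightarrow> continuous_map KH KH (\<lambda>x. h \<otimes> x)"
  by (auto simp: continuous_map_in_subtopology coarse.continuous_lmult continuous_map_from_subtopology)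

lemma rmult_KH: "h \<in> H \<Longrightarrow> continuous_map KH KH (\<lambda>x. x \<otimes> h)"
  by (auto simp: continuous_map_in_subtopology coarse.continuous_rmult continuous_map_from_subtopology)

lemma translate_KH:
  assumes "h \<in> H"
  shows "openin KH S \<Longrightarrow> openin KH {x \<in> H. h \<otimes> x \<in> S}"
    and "closedin KH S \<Longrightarrow> closedin KH {x \<in> H. h \<otimes> x \<in> S}"
    and "openin KH S \<Longrightarrow> openin KH {x \<in> H. x \<otimes> h \<in> S}"
    and "closedin KH S \<Longrightarrow> closedin KH {x \<in> H. x \<otimes> h \<in> S}"
  using openin_continuous_map_preimage[OF lmult_KH[OF assms], of S]
    closedin_continuous_map_preimage[OF lmult_KH[OF assms], of S]
    openin_continuous_map_preimage[OF rmult_KH[OF assms], of S]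
    closedin_continuous_map_preimage[OF rmult_KH[OF assms], of S]
  unfolding topspace_KH by blast+

lemma openin_KH_nbhd:
  assumes "openin KH S" "x \<in> S"
  obtains W where "coarse.nbhd W" "\<And>w. w \<in> W \<Longrightarrow> w \<in> H \<Longrightarrow> x \<otimes> w \<in> S"
proof -
  obtain S' where S': "openin K S'" "S = S' \<inter> H" using assms(1) by (auto simp: openin_subtopology)
  have "coarse.nbhd {u \<in> carrier G. x \<otimes> u \<in> S'}"
    using coarse.nbhd_translate[OF S'(1)] assms(2) S'(2) by blast
  then show thesis by (rule that) (use assms(2) S'(2) in auto)
qed

lemma closure_KH_nbhd:
  assumes "x \<in> KH closure_of A" "coarse.nbhd W"
  obtains w where "w \<in> W" "x \<otimes> w \<in> A"
proof -
  have "x \<in> K closure_of A"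
    using assms(1) closure_of_mono[of "H \<inter> A" A K] by (auto simp: closure_of_subtopology)
  then show thesis using assms(2) that unfolding coarse.in_closure_iff_nbhd by blast
qed

text \<open>Almost openness. By the Baire category theorem, one of the countably many translates of the closed
set \<open>F\<close> that cover \<open>H\<close> has an interior point \<open>y\<close>, so \<open>F\<close>
has one too. Hence the quotients of elements of \<open>F\<close>, which lie in the closure of \<open>V
\<inter> H\<close>, fill a neighborhood of the unit.\<close>

lemma closure_contains_coarse_nbhd:
  assumes V: "nbhd V"
  obtains W where "coarse.nbhd W" "W \<inter> H \<subseteq> KH closure_of (V \<inter> H)"
proof -
  obtain B where B: "nbhd B" "\<And>x. x \<in> B \<Longrightarrow> inv x \<in> B"
    "\<And>x y z. x \<in> B \<Longrightarrow> y \<in> B \<Longrightarrow> z \<in> B \<Longrightarrow> x \<otimes> y \<otimes> z \<in> V"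
    using nbhd_symmetric_cubeE[OF V] by metis
  obtain D where D: "countable D" "D \<subseteq> H" "\<And>a. a \<in> H \<Longrightarrow> \<exists>d\<in>D. inv d \<otimes> a \<in> B"
    using left_narrow_centers_in[OF H_narrow B(1)] by metis
  define F where "F = KH closure_of (B \<inter> H)"
  define P where "P d = {x \<in> H. inv d \<otimes> x \<in> F}" for d
  have "closedin KH (P d)" if "d \<in> D" for d
    unfolding P_def F_def using that D(2) by (intro translate_KH) auto
  moreover have "KH interior_of \<Union>(P ` D) \<noteq> {}"
  proof -
    have BF: "B \<inter> H \<subseteq> F" unfolding F_def by (rule closure_of_subset) auto
    have "x \<in> \<Union>(P ` D)" if x: "x \<in> H" for x
    proof -
      obtain d where d: "d \<in> D" "inv d \<otimes> x \<in> B" using D(3) x by blast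
      then have "inv d \<otimes> x \<in> H" using D(2) x by auto
      then have "x \<in> P d" using d BF x by (auto simp: P_def)
      then show ?thesis using d by blast
    qed
    then have "H \<subseteq> KH interior_of \<Union>(P ` D)"
      by (intro interior_of_maximal) (use openin_topspace[of KH] topspace_KH in auto)
    then show ?thesis using H.one_closed by blast
  qed
  ultimately have "\<exists>d\<in>D. KH interior_of (P d) \<noteq> {}"
    using Baire_KH[OF countable_image[OF D(1), of P]] by auto
  then obtain d y where d: "d \<in> D" "y \<in> KH interior_of (P d)" by blast
  obtain W where W: "coarse.nbhd W" "\<And>w. w \<in> W \<Longrightarrow> w \<in> H \<Longrightarrow> y \<otimes> w \<in> KH interior_of (P d)"
    using openin_KH_nbhd[OF openin_interior_of d(2)] by metis
  have P: "x \<in> H \<and> inv d \<otimes> x \<in> F" if "x \<in> KH interior_of (P d)" for x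
    using that interior_of_subset[of KH "P d"] by (auto simp: P_def)
  have dH: "d \<in> H" using d D by blast
  have "w \<in> KH closure_of (V \<inter> H)" if w: "w \<in> W" "w \<in> H" for w
  proof -
    have yH: "y \<in> H" using P d(2) by blast
    have FK: "F \<subseteq> K closure_of (B \<inter> H)"
      unfolding F_def closure_of_subtopology
      using closure_of_mono[of "H \<inter> (B \<inter> H)" "B \<inter> H" K] by blast
    have 1: "inv d \<otimes> y \<in> K closure_of (B \<inter> H)" "inv d \<otimes> (y \<otimes> w) \<in> K closure_of (B \<inter> H)"
      using P[OF d(2)] P[OF W(2)[OF w]] FK by blast+
    have 2: "inv a \<otimes> b \<in> V \<inter> H" if ab: "a \<in> B \<inter> H" "b \<in> B \<inter> H" for a b
    proof -
      have "inv a \<otimes> b \<otimes> \<one> \<in> V" using B(2,3) ab nbhd_one[OF B(1)] by blast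
      then show ?thesis using ab by simp
    qed
    have "inv (inv d \<otimes> y) \<otimes> (inv d \<otimes> (y \<otimes> w)) \<in> K closure_of (V \<inter> H)"
      by (rule coarse.closure_ldiv[OF 1 2])
    then have "w \<in> K closure_of (V \<inter> H)" using dH yH w by (simp add: word_simps)
    then show ?thesis using w by (simp add: closure_of_subtopology Int_commute)
  qed
  then show thesis using that W(1) by blast
qed

text \<open>Almost openness away from the unit: a set that is a neighborhood of \<open>p\<close> in \<open>(H,
T)\<close> has \<open>p\<close> in the \<open>K\<close>-interior of its \<open>K\<close>-closure.\<close>

lemma interior_closure_of_translate:
  assumes p: "p \<in> H" and A: "A \<subseteq> H" and V: "nbhd V" "\<And>v. v \<in> V \<inter> H \<Longrightarrow> p \<otimes> v \<in> A"
  shows "p \<in> KH interior_of (KH closure_of A)"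
proof -
  obtain W where W: "coarse.nbhd W" "W \<inter> H \<subseteq> KH closure_of (V \<inter> H)"
    using closure_contains_coarse_nbhd[OF V(1)] by metis
  obtain W' where W': "openin K W'" "\<one> \<in> W'" "W' \<subseteq> W" using W(1) by (auto simp: unit_nbhd_def)
  let ?S = "{y \<in> H. inv p \<otimes> y \<in> W' \<inter> H}"
  have "openin KH ?S"
    using p W'(1) by (intro translate_KH) (auto simp: openin_subtopology)
  moreover have "?S \<subseteq> KH closure_of A"
  proof
    fix y assume "y \<in> ?S"
    then have y: "y \<in> H" "inv p \<otimes> y \<in> KH closure_of (V \<inter> H)" using W' W(2) by auto
    have "(\<lambda>x. p \<otimes> x) ` (KH closure_of (V \<inter> H)) \<subseteq> KH closure_of ((\<lambda>x. p \<otimes> x) ` (V \<inter> H))"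
      by (rule continuous_map_image_closure_subset[OF lmult_KH[OF p]])
    also have "\<dots> \<subseteq> KH closure_of A" by (rule closure_of_mono) (use V(2) in blast)
    finally have "p \<otimes> (inv p \<otimes> y) \<in> KH closure_of A" using y(2) by blast
    then show "y \<in> KH closure_of A" using p y(1) by simp
  qed
  ultimately have "?S \<subseteq> KH interior_of (KH closure_of A)" by (intro interior_of_maximal)
  moreover have "p \<in> ?S" using p W'(2) by simp
  ultimately show ?thesis by blast
qed

end

section \<open>Removing the closure at generic points\<close>

locale narrow_normal_chain = narrow_normal_subgroup + balanced_chain
begin

text \<open>The interior of \<open>c U m \<inter> H\<close> in the chain topology. With countably many
\<open>c\<close> these sets form a countable base of that topology on \<open>H\<close>.\<close>

definition cell :: "'a \<Rightarrow> nat \<Rightarrow> 'a set" where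
  "cell c m = {p \<in> H. \<exists>k. \<forall>u\<in>U k. inv c \<otimes> p \<otimes> u \<in> U m}"

lemma cell_subset: "cell c m \<subseteq> H"
  by (auto simp: cell_def)

lemma cell_center: "c \<in> H \<Longrightarrow> p \<in> cell c m \<Longrightarrow> inv c \<otimes> p \<in> U m"
proof -
  assume c: "c \<in> H" and "p \<in> cell c m"
  then obtain k where k: "\<forall>u\<in>U k. inv c \<otimes> p \<otimes> u \<in> U m" and p: "p \<in> H" by (auto simp: cell_def)
  have "inv c \<otimes> p \<otimes> \<one> \<in> U m" using k chain_one by blast
  then show ?thesis using c p by simp
qed

lemma cell_absorbs:
  assumes "c \<in> H" "p \<in> cell c m"
  obtains k where "\<And>u. u \<in> U k \<inter> H \<Longrightarrow> p \<otimes> u \<in> cell c m"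
proof -
  obtain k where k: "\<forall>u\<in>U k. inv c \<otimes> p \<otimes> u \<in> U m" and p: "p \<in> H" using assms by (auto simp: cell_def)
  have "p \<otimes> u \<in> cell c m" if u: "u \<in> U (Suc k) \<inter> H" for u
  proof -
    have "inv c \<otimes> (p \<otimes> u) \<otimes> v \<in> U m" if "v \<in> U (Suc k)" for v
    proof -
      have "inv c \<otimes> p \<otimes> (u \<otimes> v) \<in> U m" using k chain_mult u that by blast
      then show ?thesis using u that p assms(1) by (simp add: m_assoc)
    qed
    then show ?thesis using u p unfolding cell_def by blast
  qed
  then show thesis using that by blast
qed

definition centers :: "'a set" where
  "centers = (SOME D. countable D \<and> D \<subseteq> H \<and> \<one> \<in> D \<and> (\<forall>m. \<forall>a\<in>H. \<exists>d\<in>D. inv d \<otimes> a \<in> U m))"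

lemma centers: "countable centers" "centers \<subseteq> H" "\<one> \<in> centers"
  "a \<in> H \<Longrightarrow> \<exists>d\<in>centers. inv d \<otimes> a \<in> U m"
proof -
  have "\<exists>D. countable D \<and> D \<subseteq> H \<and> (\<forall>a\<in>H. \<exists>d\<in>D. inv d \<otimes> a \<in> U m)" for m
    using left_narrow_centers_in[OF H_narrow chain_nbhd[of m]] by metis
  then obtain D where D: "\<And>m. countable (D m)" "\<And>m. D m \<subseteq> H"
    "\<And>m a. a \<in> H \<Longrightarrow> \<exists>d\<in>D m. inv d \<otimes> a \<in> U m" by metis
  have "\<exists>D. countable D \<and> D \<subseteq> H \<and> \<one> \<in> D \<and> (\<forall>m. \<forall>a\<in>H. \<exists>d\<in>D. inv d \<otimes> a \<in> U m)"
  proof (intro exI conjI allI ballI)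
    show "countable (insert \<one> (\<Union>m. D m))" using D(1) by auto
    show "insert \<one> (\<Union>m. D m) \<subseteq> H" using D(2) by auto
    show "\<exists>d\<in>insert \<one> (\<Union>m. D m). inv d \<otimes> a \<in> U m" if "a \<in> H" for a m
      using D(3)[OF that] by blast
  qed simp
  from someI_ex[OF this] show "countable centers" "centers \<subseteq> H" "\<one> \<in> centers"
    "a \<in> H \<Longrightarrow> \<exists>d\<in>centers. inv d \<otimes> a \<in> U m"
    unfolding centers_def[symmetric] by simp_all
qed

lemma centers_H [simp]: "c \<in> centers \<Longrightarrow> c \<in> H"
  using centers(2) by blast

text \<open>The pair \<open>(c, m)\<close> stands for \<open>cell c m\<close>.\<close>

definition refines :: "nat \<Rightarrow> 'a \<times> nat \<Rightarrow> 'a \<times> nat \<Rightarrow> bool" where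
  "refines n s t \<longleftrightarrow> fst t \<in> centers \<and> cell (fst t) (snd t) \<subseteq> cell (fst s) (snd s) \<and>
    small n (cell (fst t) (snd t))"

text \<open>All points of a small cell around \<open>p\<close> have the form \<open>p s\<close> with small
\<open>s\<close>. This bounds \<open>inv a \<otimes> b\<close> directly, while \<open>a \<otimes> inv
b\<close> is a conjugate by \<open>p\<close> of a small element; the cell is chosen after \<open>p\<close>, so
the conjugation can be compensated.\<close>

lemma refining_cell:
  assumes c: "c \<in> centers" and p: "p \<in> cell c m"
  shows "\<exists>d j. refines n (c, m) (d, j) \<and> p \<in> cell d j"
proof -
  obtain k where k: "\<And>u. u \<in> U k \<inter> H \<Longrightarrow> p \<otimes> u \<in> cell c m"
    using cell_absorbs[OF centers_H[OF c] p] by metis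
  have pH: "p \<in> H" using p cell_subset by blast
  obtain i where i: "n \<le> i" "\<And>x. x \<in> U i \<Longrightarrow> p \<otimes> x \<otimes> inv p \<in> U n"
    using chain_conj_ge[of p n] pH by (metis H_carrier)
  define r where "r = max i k"
  obtain d where d: "d \<in> centers" "inv d \<otimes> p \<in> U (Suc (Suc (Suc r)))" using centers(4) pH by blast
  have dH: "d \<in> H" using d by simp
  have pd: "inv d \<otimes> p \<in> U (Suc (Suc r))" using d(2) chain_mono[of "Suc (Suc r)" "Suc (Suc (Suc r))"] by auto
  have "p \<in> cell d (Suc (Suc r))"
    unfolding cell_def using pH d(2) chain_mult by blast
  moreover have s: "inv p \<otimes> q \<in> U (Suc r) \<and> q \<in> H" if q: "q \<in> cell d (Suc (Suc r))" for q
  proof -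
    have qH: "q \<in> H" using q cell_subset by blast
    have "inv (inv d \<otimes> p) \<otimes> (inv d \<otimes> q) \<in> U (Suc r)"
      by (rule chain_mult[OF chain_inv[OF pd] cell_center[OF dH q]])
    then show ?thesis using pH qH dH by (simp add: word_simps)
  qed
  have "cell d (Suc (Suc r)) \<subseteq> cell c m"
  proof
    fix q assume q: "q \<in> cell d (Suc (Suc r))"
    have "U (Suc r) \<subseteq> U k" by (rule chain_mono) (simp add: r_def)
    then have "p \<otimes> (inv p \<otimes> q) \<in> cell c m" using s[OF q] pH by (intro k) auto
    then show "q \<in> cell c m" using s[OF q] pH by simp
  qed
  moreover have "small n (cell d (Suc (Suc r)))"
    unfolding small_def
  proof (intro ballI)
    fix a b assume a: "a \<in> cell d (Suc (Suc r))" and b: "b \<in> cell d (Suc (Suc r))"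
    have car: "a \<in> carrier G" "b \<in> carrier G" "p \<in> carrier G" using s[OF a] s[OF b] pH by auto
    have ri: "U r \<subseteq> U i" "U r \<subseteq> U n" using i(1) by (auto intro!: chain_mono simp: r_def)
    have "inv (inv p \<otimes> a) \<otimes> (inv p \<otimes> b) \<in> U r" "(inv p \<otimes> a) \<otimes> inv (inv p \<otimes> b) \<in> U r"
      using chain_mult[OF chain_inv[of "inv p \<otimes> a" "Suc r"], of "inv p \<otimes> b"]
        chain_mult[OF _ chain_inv[of "inv p \<otimes> b" "Suc r"], of "inv p \<otimes> a"]
        s[OF a] s[OF b] by blast+
    then have "inv (inv p \<otimes> a) \<otimes> (inv p \<otimes> b) \<in> U n"
      "p \<otimes> ((inv p \<otimes> a) \<otimes> inv (inv p \<otimes> b)) \<otimes> inv p \<in> U n"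
      using ri i(2) by blast+
    then show "inv a \<otimes> b \<in> U n \<and> a \<otimes> inv b \<in> U n" using car by (simp add: word_simps)
  qed
  ultimately show ?thesis using d(1) unfolding refines_def by auto
qed

text \<open>Outside these sets, a point in the closure of a cell can be approximated by smaller and smaller
cells. They are nowhere dense by almost openness: every point of the cell lies in a smaller cell, and so in
one of the interiors that are removed.\<close>

definition bad :: "'a \<times> nat \<Rightarrow> nat \<Rightarrow> 'a set" where
  "bad s n = KH closure_of (cell (fst s) (snd s)) -
     \<Union>{KH interior_of (KH closure_of (cell (fst t) (snd t))) | t. refines n s t}"

lemma bad_closed: "closedin KH (bad s n)"
  unfolding bad_def by (intro closedin_diff closedin_closure_of openin_Union) auto

lemma bad_nowhere_dense:
  assumes "fst s \<in> centers"
  shows "KH interior_of (bad s n) = {}"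
proof (rule ccontr)
  assume "KH interior_of (bad s n) \<noteq> {}"
  then obtain y where y: "y \<in> KH interior_of (bad s n)" by blast
  then have "y \<in> KH closure_of (cell (fst s) (snd s))"
    using interior_of_subset[of KH "bad s n"] by (auto simp: bad_def)
  then obtain p where p: "p \<in> cell (fst s) (snd s)" "p \<in> KH interior_of (bad s n)"
    using y openin_interior_of[of KH "bad s n"] unfolding in_closure_of by blast
  obtain t where t: "refines n s t" "p \<in> cell (fst t) (snd t)"
    using refining_cell[OF assms p(1), of n] by (metis fst_conv snd_conv surjective_pairing)
  have tc: "fst t \<in> H" using t(1) by (simp add: refines_def)
  obtain k where k: "\<And>u. u \<in> U k \<inter> H \<Longrightarrow> p \<otimes> u \<in> cell (fst t) (snd t)"
    using cell_absorbs[OF tc t(2)] by metis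
  have "p \<in> KH interior_of (KH closure_of (cell (fst t) (snd t)))"
    using p(1) cell_subset chain_nbhd k by (intro interior_closure_of_translate) blast+
  then have "p \<notin> bad s n" using t(1) unfolding bad_def by blast
  then show False using p(2) interior_of_subset[of KH "bad s n"] by blast
qed

definition bads :: "'a set set" where
  "bads = (\<lambda>(s, n). bad s n) ` ((centers \<times> UNIV) \<times> UNIV)"

lemma countable_bads: "countable bads"
  unfolding bads_def using centers(1) by (intro countable_image countable_SIGMA) auto

lemma bads_closed_nowhere_dense: "B \<in> bads \<Longrightarrow> closedin KH B \<and> KH interior_of B = {}"
  unfolding bads_def using bad_closed bad_nowhere_dense by auto

lemma not_bad_refine:
  assumes "x \<notin> \<Union>bads" "fst s \<in> centers" "x \<in> KH closure_of (cell (fst s) (snd s))"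
  shows "\<exists>t. refines n s t \<and> x \<in> KH closure_of (cell (fst t) (snd t))"
proof -
  have "bad s n \<in> bads" unfolding bads_def using assms(2) by (cases s) force
  then have "x \<notin> bad s n" using assms(1) by blast
  then obtain t where "refines n s t" "x \<in> KH interior_of (KH closure_of (cell (fst t) (snd t)))"
    using assms(3) unfolding bad_def by blast
  then show ?thesis using interior_of_subset[of KH "KH closure_of (cell (fst t) (snd t))"] by blast
qed

text \<open>At a point outside the bad sets, refine repeatedly: \<open>x\<close> is in the
\<open>K\<close>-closures of decreasing cells whose sizes tend to zero on both sides. Any choice of points
\<open>p n\<close> in these cells is a two-sided Cauchy sequence, and points of the cells that are
\<open>K\<close>-close to \<open>x\<close> are close to \<open>p\<close> in the chain topology. By
completeness \<open>p\<close> converges to \<open>x\<close>.\<close>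

lemma not_bad_in_U:
  assumes x: "x \<in> H" "x \<notin> \<Union>bads" "x \<in> KH closure_of (cell \<one> 1)"
  shows "x \<in> U 0"
proof -
  let ?c = "\<lambda>s. cell (fst s) (snd s)"
  let ?P = "\<lambda>n s. fst s \<in> centers \<and> x \<in> KH closure_of ?c s \<and> ?c s \<subseteq> cell \<one> 1"
  have "\<exists>f. \<forall>n. ?P n (f n) \<and> refines n (f n) (f (Suc n))"
  proof (rule dependent_nat_choice)
    show "\<exists>s. ?P 0 s" using x(3) centers(3) by (intro exI[of _ "(\<one>, 1)"]) simp
    fix s n assume s: "?P n s"
    then obtain t where "refines n s t" "x \<in> KH closure_of ?c t" using not_bad_refine x(2) by blast
    then show "\<exists>t. ?P (Suc n) t \<and> refines n s t" using s unfolding refines_def by blast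
  qed
  then obtain f where f: "\<And>n. ?P n (f n)" "\<And>n. refines n (f n) (f (Suc n))" by blast
  have nested: "?c (f n) \<subseteq> ?c (f m)" if "m \<le> n" for m n
  proof (rule lift_Suc_antimono_le[of "\<lambda>n. ?c (f n)", OF _ that])
    show "?c (f (Suc n)) \<subseteq> ?c (f n)" for n using f(2)[of n] unfolding refines_def by blast
  qed
  have "\<exists>p. p \<in> ?c (f n)" for n
  proof -
    have "KH closure_of ?c (f n) \<noteq> {}" using f(1)[of n] by blast
    then have "?c (f n) \<noteq> {}" by (metis closure_of_empty)
    then show ?thesis by blast
  qed
  then obtain p where p: "\<And>n. p n \<in> ?c (f n)" by metis
  have near: "inv (p j) \<otimes> q \<in> U n \<and> p j \<otimes> inv q \<in> U n" if "Suc n \<le> j" "q \<in> ?c (f (Suc n))" for j n q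
    using f(2)[of n] p[of j] nested[OF that(1)] that(2) unfolding refines_def small_def by blast
  have pc: "cauchy p"
  proof (rule cauchyI)
    show "p k \<in> carrier G" for k using p cell_subset H_carrier by blast
    show "\<exists>N. \<forall>j\<ge>N. \<forall>k\<ge>N. inv (p j) \<otimes> p k \<in> U n \<and> p j \<otimes> inv (p k) \<in> U n" for n
      using near p nested by (intro exI[of _ "Suc n"]) blast
  qed
  have "\<forall>\<^sub>F k in sequentially. inv (p k) \<otimes> x \<in> U 1"
  proof (rule cauchy_converges[OF balanced_chain_axioms pc])
    fix W n assume W: "coarse.nbhd W"
    obtain w where w: "w \<in> W" "x \<otimes> w \<in> ?c (f (Suc n))"
      using closure_KH_nbhd[OF _ W] f(1)[of "Suc n"] by metis
    have wG: "w \<in> carrier G" using w(1) coarse.nbhd_subset[OF W] by blast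
    have "\<forall>\<^sub>F k in sequentially. inv (p k) \<otimes> (x \<otimes> w) \<in> U n"
      using eventually_ge_at_top[of "Suc n"] by (rule eventually_mono) (use near w(2) in blast)
    then show "\<exists>y\<in>carrier G. inv x \<otimes> y \<in> W \<and> (\<forall>\<^sub>F k in sequentially. inv (p k) \<otimes> y \<in> U n)"
      using x(1) w(1) wG by (intro bexI[of _ "x \<otimes> w"]) auto
  qed (use x(1) in simp)
  then obtain k where k: "inv (p k) \<otimes> x \<in> U 1" by (auto simp: eventually_sequentially)
  have pk: "p k \<in> cell \<one> 1" using p f(1) by blast
  then have pkG: "p k \<in> carrier G" using cell_subset H_carrier by blast
  have "p k \<in> U (Suc 0)" using cell_center[OF H.one_closed pk] pkG by simp
  then have "p k \<otimes> (inv (p k) \<otimes> x) \<in> U 0" using chain_mult[of "p k" 0] k by simp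
  then show ?thesis using pkG x(1) by simp
qed

text \<open>The argument of Pettis' theorem: for \<open>w\<close> near the unit, the sets of \<open>x\<close>
with \<open>x\<close> bad or \<open>x w\<close> bad are both meagre in \<open>(H, K)\<close>, so some
\<open>x\<close> near the unit avoids them. Then \<open>x\<close> and \<open>x w\<close> are both in \<open>U
0\<close>.\<close>

lemma coarse_nbhd_in_quotients:
  obtains W where "coarse.nbhd W" "\<And>w. w \<in> W \<Longrightarrow> w \<in> H \<Longrightarrow> \<exists>a\<in>U 0. \<exists>b\<in>U 0. w = inv a \<otimes> b"
proof -
  obtain W where W: "coarse.nbhd W" "W \<inter> H \<subseteq> KH closure_of (U 2 \<inter> H)"
    using closure_contains_coarse_nbhd[OF chain_nbhd[of 2]] by metis
  have "U 2 \<inter> H \<subseteq> cell \<one> 1"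
  proof
    fix u assume u: "u \<in> U 2 \<inter> H"
    then have "\<forall>v\<in>U 2. inv \<one> \<otimes> u \<otimes> v \<in> U 1"
      using chain_mult[of _ 1] by (auto simp: numeral_2_eq_2)
    then show "u \<in> cell \<one> 1" using u unfolding cell_def by blast
  qed
  then have Wc: "W \<inter> H \<subseteq> KH closure_of (cell \<one> 1)" using W(2) closure_of_mono by blast
  obtain V where V: "coarse.nbhd V" "V \<subseteq> W"
    "\<And>x y z. x \<in> V \<Longrightarrow> y \<in> V \<Longrightarrow> z \<in> V \<Longrightarrow> x \<otimes> y \<otimes> z \<in> W"
    using coarse.nbhd_symmetric_cubeE[OF W(1)] by metis
  obtain V' where V': "openin K V'" "\<one> \<in> V'" "V' \<subseteq> V" using V(1) by (auto simp: unit_nbhd_def)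
  have "\<exists>a\<in>U 0. \<exists>b\<in>U 0. w = inv a \<otimes> b" if w: "w \<in> V" "w \<in> H" for w
  proof -
    let ?tr = "\<lambda>B. {x \<in> H. x \<otimes> w \<in> B}"
    have tr: "closedin KH (?tr B) \<and> KH interior_of (?tr B) = {}" if B: "B \<in> bads" for B
    proof
      show "closedin KH (?tr B)"
        using bads_closed_nowhere_dense[OF B] by (intro translate_KH w) auto
      let ?S = "{z \<in> H. z \<otimes> inv w \<in> KH interior_of (?tr B)}"
      have "openin KH ?S" using w by (intro translate_KH) auto
      moreover have "?S \<subseteq> B"
      proof
        fix z assume z: "z \<in> ?S"
        then have "z \<otimes> inv w \<otimes> w \<in> B" using interior_of_subset[of KH "?tr B"] by blast
        then show "z \<in> B" using z w by (simp add: m_assoc)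
      qed
      ultimately have "?S \<subseteq> KH interior_of B" by (intro interior_of_maximal)
      then have S: "?S = {}" using bads_closed_nowhere_dense[OF B] by blast
      have "y \<otimes> w \<in> ?S" if y: "y \<in> KH interior_of (?tr B)" for y
      proof -
        have "y \<in> H" using y interior_of_subset[of KH "?tr B"] by auto
        then show ?thesis using y w by (simp add: m_assoc)
      qed
      then show "KH interior_of (?tr B) = {}" using S by blast
    qed
    have "KH interior_of \<Union>(bads \<union> ?tr ` bads) = {}"
      by (rule Baire_KH) (use countable_bads bads_closed_nowhere_dense tr in auto)
    moreover have "openin KH (V' \<inter> H)" using V'(1) by (auto simp: openin_subtopology)
    ultimately have "\<not> V' \<inter> H \<subseteq> \<Union>(bads \<union> ?tr ` bads)"
      using V'(2) H.one_closed interior_of_maximal[of "V' \<inter> H" "\<Union>(bads \<union> ?tr ` bads)" KH] by blast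
    then obtain x where x: "x \<in> V'" "x \<in> H" "x \<notin> \<Union>(bads \<union> ?tr ` bads)" by blast
    have xw: "x \<otimes> w \<in> H" "x \<otimes> w \<notin> \<Union>bads" using x w by auto
    have "x \<otimes> w \<otimes> \<one> \<in> W" using V(3) V'(3) x(1) w coarse.nbhd_one[OF V(1)] by blast
    then have "x \<otimes> w \<in> W" using x w by simp
    then have "x \<otimes> w \<in> U 0" using xw Wc by (intro not_bad_in_U) auto
    moreover have "x \<in> U 0" using x V'(3) V(2) Wc by (intro not_bad_in_U) auto
    moreover have "w = inv x \<otimes> (x \<otimes> w)" using x w by simp
    ultimately show ?thesis by blast
  qed
  then show thesis using that V(1) by blast
qed

end

text \<open>By the preceding lemma, every \<open>T\<close>-neighborhood of the unit contains a
\<open>K\<close>-neighborhood of the unit in \<open>H\<close>, so the identity of \<open>H\<close> is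
continuous from \<open>K\<close> to \<open>T\<close> and carries compactness over.\<close>

lemma (in narrow_normal_subgroup) compactin_narrow:
  assumes bal: "omega_balanced G T"
  shows "compactin T H"
proof -
  have fine: "\<exists>W. coarse.nbhd W \<and> W \<inter> H \<subseteq> V" if V: "nbhd V" for V
  proof -
    obtain B where B: "nbhd B" "\<And>x. x \<in> B \<Longrightarrow> inv x \<in> B"
      "\<And>x y z. x \<in> B \<Longrightarrow> y \<in> B \<Longrightarrow> z \<in> B \<Longrightarrow> x \<otimes> y \<otimes> z \<in> V"
      using nbhd_symmetric_cubeE[OF V] by metis
    obtain U where U: "balanced_chain G T U" "U 0 \<subseteq> B"
      using balanced_chain_exists[OF bal B(1)] by metis
    interpret balanced_chain G T U by fact
    interpret narrow_normal_chain G T K H U ..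
    obtain W where W: "coarse.nbhd W" "\<And>w. w \<in> W \<Longrightarrow> w \<in> H \<Longrightarrow> \<exists>a\<in>U 0. \<exists>b\<in>U 0. w = inv a \<otimes> b"
      using coarse_nbhd_in_quotients by metis
    have "w \<in> V" if w: "w \<in> W" "w \<in> H" for w
    proof -
      obtain a b where ab: "a \<in> U 0" "b \<in> U 0" "w = inv a \<otimes> b" using W(2) w by blast
      then have "inv a \<otimes> b \<otimes> \<one> \<in> V" using U(2) B(2,3) nbhd_one[OF B(1)] by blast
      then show ?thesis using ab by simp
    qed
    then show ?thesis using W(1) by blast
  qed
  have "continuous_map KH T id"
    unfolding continuous_map_def
  proof (intro conjI allI impI)
    show "id \<in> topspace KH \<rightarrow> topspace T" by (simp add: topspace_eq)
    fix O' assume O': "openin T O'"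
    have "\<exists>S. openin KH S \<and> x \<in> S \<and> S \<subseteq> {x \<in> topspace KH. id x \<in> O'}"
      if x: "x \<in> {x \<in> topspace KH. id x \<in> O'}" for x
    proof -
      have xH: "x \<in> H" "x \<in> O'" using x by auto
      obtain W where W: "coarse.nbhd W" "W \<inter> H \<subseteq> {u \<in> carrier G. x \<otimes> u \<in> O'}"
        using fine[OF nbhd_translate[OF O' xH(2)]] by blast
      obtain W' where W': "openin K W'" "\<one> \<in> W'" "W' \<subseteq> W" using W(1) by (auto simp: unit_nbhd_def)
      let ?S = "{y \<in> H. inv x \<otimes> y \<in> W' \<inter> H}"
      have "openin KH ?S"
        using W'(1) xH by (intro translate_KH) (auto simp: openin_subtopology)
      moreover have "x \<in> ?S" using xH W'(2) by simp
      moreover have "?S \<subseteq> {x \<in> topspace KH. id x \<in> O'}"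
      proof
        fix y assume y: "y \<in> ?S"
        then have "x \<otimes> (inv x \<otimes> y) \<in> O'" using W(2) W'(3) by blast
        then show "y \<in> {x \<in> topspace KH. id x \<in> O'}" using y xH by simp
      qed
      ultimately show ?thesis by (intro exI[of _ ?S] conjI)
    qed
    then show "openin KH {x \<in> topspace KH. id x \<in> O'}" by (subst openin_subopen) (rule ballI)
  qed
  moreover have "compactin KH H" using compact_KH unfolding compact_space_def topspace_KH .
  ultimately have "compactin T (id ` H)" by (metis image_compactin)
  then show ?thesis by simp
qed

section \<open>The omega-conjucenter\<close>

context topological_group
begin

lemma iTG_closed_MAP_over_compact:
  assumes closed: "iTG_closed TYPE('a set set) G T" and MAP: "MAP_group TYPE('k) G T"
  obtains K where "iTG_closed_over_compact G T K"
proof -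
  obtain L :: "'k monoid" and S f where L: "topological_group L S" "compact_space S"
    and f: "inj_cont_hom G T L S f"
    using MAP unfolding MAP_group_def by blast
  interpret L: topological_group L S by fact
  interpret f: group_hom G L f by unfold_locales (use f in \<open>simp add: inj_cont_hom_def\<close>)
  have inj: "inj_on f (carrier G)" and cont: "continuous_map T S f"
    using f by (auto simp: inj_cont_hom_def)
  define K where "K = pullback_topology (carrier G) f S"
  have openK: "openin K W \<longleftrightarrow> (\<exists>V. openin S V \<and> W = f -` V \<inter> carrier G)" for W
    by (simp add: K_def openin_pullback_topology)
  have topK: "topspace K = carrier G"
    by (auto simp: K_def topspace_pullback_topology L.topspace_eq)
  have f_cont: "continuous_map K S f"
    unfolding K_def using continuous_map_pullback[OF continuous_map_id] by (metis id_comp)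
  have lift: "continuous_map R K g"
    if "continuous_map R S (\<lambda>x. f (g x))" "\<And>x. x \<in> topspace R \<Longrightarrow> g x \<in> carrier G"
    for R :: "'c topology" and g
    unfolding K_def using that by (intro continuous_map_pullback') (auto simp: o_def)
  have K: "topological_group G K"
  proof (intro topological_group.intro is_group topological_group_axioms.intro topK)
    have "continuous_map (prod_topology K K) (prod_topology S S) (\<lambda>(x, y). (f x, f y))"
      using f_cont by (simp add: continuous_map_prod_top)
    from continuous_map_compose[OF this L.continuous_mult]
    have "continuous_map (prod_topology K K) S (\<lambda>p. f (case p of (x, y) \<Rightarrow> x \<otimes> y))"
      by (rule continuous_map_eq) (auto simp: topK)
    then show "continuous_map (prod_topology K K) K (\<lambda>(x, y). x \<otimes> y)"
      by (rule lift) (auto simp: topK)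
    from continuous_map_compose[OF f_cont L.continuous_inv]
    have "continuous_map K S (\<lambda>x. f (inv x))"
      by (rule continuous_map_eq) (auto simp: topK)
    then show "continuous_map K K (\<lambda>x. inv x)"
      by (rule lift) (auto simp: topK)
    show "Hausdorff_space K"
      unfolding Hausdorff_space_def
    proof (intro allI impI)
      fix x y assume xy: "x \<in> topspace K \<and> y \<in> topspace K \<and> x \<noteq> y"
      then have "f x \<noteq> f y" "f x \<in> topspace S" "f y \<in> topspace S"
        using inj by (auto simp: topK L.topspace_eq inj_on_def)
      then obtain U V where "openin S U" "openin S V" "f x \<in> U" "f y \<in> V" "disjnt U V"
        using L.Hausdorff unfolding Hausdorff_space_def by metis
      then show "\<exists>U V. openin K U \<and> openin K V \<and> x \<in> U \<and> y \<in> V \<and> disjnt U V"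
        using xy by (intro exI[of _ "f -` U \<inter> carrier G"] exI[of _ "f -` V \<inter> carrier G"])
          (auto simp: openK topK disjnt_iff)
    qed
  qed
  moreover have "compact_space K"
  proof -
    let ?g = "inv_into (carrier G) f"
    have "closedin S (f ` carrier G)"
      using iTG_closed_all_types[OF topological_group_axioms closed, where 'y = 'k] L(1) f
      unfolding iTG_closed_def by blast
    then have "compactin S (f ` carrier G)" by (rule closedin_compact_space[OF L(2)])
    then have comp: "compactin (subtopology S (f ` carrier G)) (f ` carrier G)"
      by (simp add: compactin_subtopology)
    have "continuous_map (subtopology S (f ` carrier G)) S id"
      by (simp add: continuous_map_from_subtopology)
    then have "continuous_map (subtopology S (f ` carrier G)) S (\<lambda>x. f (?g x))"
      by (rule continuous_map_eq) (auto simp: f_inv_into_f)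
    then have "continuous_map (subtopology S (f ` carrier G)) K ?g"
      by (rule lift) (auto intro: inv_into_into)
    then have "compactin K (?g ` f ` carrier G)" by (rule image_compactin[OF comp])
    moreover have "?g ` f ` carrier G = carrier G"
      using inj by (simp add: image_comp o_def cong: image_cong)
    ultimately show ?thesis by (simp add: compact_space_def topK)
  qed
  moreover have "openin T W" if W: "openin K W" for W
  proof -
    obtain V where V: "openin S V" "W = f -` V \<inter> carrier G" using W unfolding openK by (elim exE conjE)
    have "openin T {x \<in> topspace T. f x \<in> V}" by (rule openin_continuous_map_preimage[OF cont V(1)])
    moreover have "{x \<in> topspace T. f x \<in> V} = W" using V(2) by (auto simp: topspace_eq)
    ultimately show ?thesis by simp
  qed
  ultimately have "iTG_closed_over_compact G T K"
    by (intro iTG_closed_over_compact.intro iTG_closed_over_compact_axioms.intro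
        topological_group_axioms closed)
  then show thesis by (rule that)
qed

lemma compactin_finite_translates:
  assumes H: "compactin T H" and V: "nbhd V"
  obtains F where "finite F" "F \<subseteq> H" "\<And>y. y \<in> H \<Longrightarrow> \<exists>h\<in>F. inv h \<otimes> y \<in> V"
proof -
  have HG: "H \<subseteq> carrier G" using compactin_subset_topspace[OF H] by (simp add: topspace_eq)
  obtain W where W: "openin T W" "\<one> \<in> W" "W \<subseteq> V" using V by (auto simp: unit_nbhd_def)
  define P where "P h = {y \<in> topspace T. inv h \<otimes> y \<in> W}" for h
  have "openin T (P h)" if "h \<in> H" for h
    unfolding P_def using that HG W(1) by (intro openin_continuous_map_preimage[OF continuous_lmult]) auto
  moreover have "H \<subseteq> \<Union>(P ` H)" using HG W(2) by (force simp: P_def topspace_eq)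
  ultimately obtain \<F> where "finite \<F>" "\<F> \<subseteq> P ` H" "H \<subseteq> \<Union>\<F>"
    using compactinD[OF H, of "P ` H"] by blast
  moreover from this obtain F where F: "F \<subseteq> H" "finite F" "\<F> = P ` F"
    using finite_subset_image[of \<F> P H] by blast
  ultimately have "H \<subseteq> \<Union>(P ` F)" by blast
  then have "\<exists>h\<in>F. inv h \<otimes> y \<in> V" if "y \<in> H" for y
    using that W(3) unfolding P_def by blast
  then show thesis using that F by blast
qed

lemma conjugacy_class_self: "z \<in> carrier G \<Longrightarrow> z \<in> conjugacy_class G z"
  unfolding conjugacy_class_def by (rule CollectI, rule exI[of _ \<one>]) simp

lemma conjugacy_class_conj:
  assumes "z \<in> carrier G" "y \<in> conjugacy_class G z" "g \<in> carrier G"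
  shows "g \<otimes> y \<otimes> inv g \<in> conjugacy_class G z"
proof -
  obtain x where "x \<in> carrier G" "y = x \<otimes> z \<otimes> inv x" using assms(2) by (auto simp: conjugacy_class_def)
  then show ?thesis
    unfolding conjugacy_class_def using assms by (intro CollectI exI[of _ "g \<otimes> x"]) (simp add: word_simps)
qed

lemma conjugacy_class_inv:
  assumes "z \<in> carrier G"
  shows "conjugacy_class G (inv z) = (\<lambda>x. inv x) ` conjugacy_class G z"
proof -
  have "conjugacy_class G (inv z) = (\<lambda>x. x \<otimes> inv z \<otimes> inv x) ` carrier G"
    by (auto simp: conjugacy_class_def)
  also have "\<dots> = (\<lambda>x. inv (x \<otimes> z \<otimes> inv x)) ` carrier G"
    using assms by (intro image_cong) (simp_all add: word_simps)
  also have "\<dots> = (\<lambda>x. inv x) ` conjugacy_class G z"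
    unfolding conjugacy_class_def by blast
  finally show ?thesis .
qed

lemma omega_conjucenter_iff:
  "z \<in> omega_conjucenter G T \<longleftrightarrow> z \<in> carrier G \<and> left_narrow (conjugacy_class G z) \<and>
    left_narrow ((\<lambda>x. inv x) ` conjugacy_class G z)"
  by (simp add: omega_conjucenter_def omega_narrow_iff_left_narrow)

lemma omega_conjucenter_inv:
  assumes "z \<in> omega_conjucenter G T" shows "inv z \<in> omega_conjucenter G T"
proof -
  have z: "z \<in> carrier G" using assms by (simp add: omega_conjucenter_iff)
  then have "(\<lambda>x. inv x) ` conjugacy_class G (inv z) = conjugacy_class G z"
    using conjugacy_class_inv[of "inv z"] by simp
  then show ?thesis using assms z conjugacy_class_inv[of z] by (simp add: omega_conjucenter_iff)
qed

lemma omega_conjucenter_conj: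
  assumes z: "z \<in> omega_conjucenter G T" and g: "g \<in> carrier G"
  shows "g \<otimes> z \<otimes> inv g \<in> omega_conjucenter G T"
proof -
  have zG: "z \<in> carrier G" using z by (simp add: omega_conjucenter_iff)
  have "conjugacy_class G (g \<otimes> z \<otimes> inv g) \<subseteq> conjugacy_class G z"
  proof
    fix y assume "y \<in> conjugacy_class G (g \<otimes> z \<otimes> inv g)"
    then obtain x where "x \<in> carrier G" "y = x \<otimes> (g \<otimes> z \<otimes> inv g) \<otimes> inv x"
      by (auto simp: conjugacy_class_def)
    then show "y \<in> conjugacy_class G z"
      using conjugacy_class_conj zG g conjugacy_class_self by simp
  qed
  then show ?thesis
    using z zG g left_narrow_mono unfolding omega_conjucenter_iff by (meson image_mono inv_closed m_closed)
qed

text \<open>A normal subgroup contains the conjugacy classes of its elements.\<close>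

lemma left_narrow_normal_subset_omega_conjucenter:
  assumes "H \<lhd> G" "left_narrow H"
  shows "H \<subseteq> omega_conjucenter G T"
proof
  interpret H: normal H G by fact
  fix h assume h: "h \<in> H"
  then have "conjugacy_class G h \<subseteq> H" using H.inv_op_closed2 by (auto simp: conjugacy_class_def)
  moreover from this have "(\<lambda>x. inv x) ` conjugacy_class G h \<subseteq> H" by blast
  ultimately show "h \<in> omega_conjucenter G T"
    using h assms(2) left_narrow_mono H.subset unfolding omega_conjucenter_iff by blast
qed

end

context iTG_closed_over_compact
begin

lemma compact_normal_hull:
  assumes bal: "omega_balanced G T"
    and S: "left_narrow S" "left_narrow ((\<lambda>x. inv x) ` S)"
    and conj: "\<And>s g. s \<in> S \<Longrightarrow> g \<in> carrier G \<Longrightarrow> g \<otimes> s \<otimes> inv g \<in> S"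
  obtains H where "H \<lhd> G" "left_narrow H" "S \<subseteq> H" "compactin T H"
proof -
  obtain H where H: "H \<lhd> G" "closedin T H" "left_narrow H" "S \<subseteq> H"
    using left_narrow_normal_hull[OF S conj] by metis
  interpret narrow_normal_subgroup G T K H
    by (intro narrow_normal_subgroup.intro narrow_normal_subgroup_axioms.intro
        iTG_closed_over_compact_axioms H)
  show thesis using that H compactin_narrow[OF bal] by blast
qed

text \<open>In fact the \<open>\<omega>\<close>-conjucenter is precompact. Otherwise it contains a sequence
\<open>a\<close> with \<open>inv (a i) \<otimes> a n \<notin> U\<close> for all \<open>i < n\<close>. The
union of the conjugacy classes of this sequence is narrow, being a countable union of narrow sets, so the
sequence lies in a compact subgroup, which is covered by finitely many small translates; one of them contains
two members of the sequence.\<close>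

lemma left_narrow_omega_conjucenter:
  assumes bal: "omega_balanced G T"
  shows "left_narrow (omega_conjucenter G T)"
  unfolding left_narrow_def
proof (intro conjI allI impI)
  let ?Z = "omega_conjucenter G T"
  show ZG: "?Z \<subseteq> carrier G" by (auto simp: omega_conjucenter_def)
  fix U assume U: "nbhd U"
  have "\<exists>F. finite F \<and> F \<subseteq> ?Z \<and> (\<forall>z\<in>?Z. \<exists>c\<in>F. inv c \<otimes> z \<in> U)"
  proof (rule ccontr)
    assume *: "\<nexists>F. finite F \<and> F \<subseteq> ?Z \<and> (\<forall>z\<in>?Z. \<exists>c\<in>F. inv c \<otimes> z \<in> U)"
    have "\<exists>a. \<forall>n::nat. a n \<in> ?Z \<and> (\<forall>i<n. inv (a i) \<otimes> a n \<notin> U)"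
    proof (rule dependent_wf_choice[of less_than "\<lambda>a n z. z \<in> ?Z \<and> (\<forall>i<n. inv (a i) \<otimes> z \<notin> U)"])
      fix n and a :: "nat \<Rightarrow> 'a"
      assume "\<And>m. (m, n) \<in> less_than \<Longrightarrow> a m \<in> ?Z \<and> (\<forall>i<m. inv (a i) \<otimes> a m \<notin> U)"
      then have "finite (a ` {..<n})" "a ` {..<n} \<subseteq> ?Z" by auto
      then have "\<not> (\<forall>z\<in>?Z. \<exists>c\<in>a ` {..<n}. inv c \<otimes> z \<in> U)" using * by blast
      then show "\<exists>z. z \<in> ?Z \<and> (\<forall>i<n. inv (a i) \<otimes> z \<notin> U)" by blast
    qed auto
    then obtain a :: "nat \<Rightarrow> 'a" where a: "\<And>n. a n \<in> ?Z" "\<And>i n. i < n \<Longrightarrow> inv (a i) \<otimes> a n \<notin> U"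
      by blast
    have aG: "a n \<in> carrier G" for n using a(1) ZG by blast
    define S where "S = (\<Union>n. conjugacy_class G (a n))"
    have invS: "(\<lambda>x. inv x) ` S = (\<Union>n. (\<lambda>x. inv x) ` conjugacy_class G (a n))"
      by (auto simp: S_def)
    have "left_narrow S" "left_narrow ((\<lambda>x. inv x) ` S)"
      unfolding invS unfolding S_def using a(1) by (auto intro!: left_narrow_UN simp: omega_conjucenter_iff)
    moreover have "g \<otimes> s \<otimes> inv g \<in> S" if "s \<in> S" "g \<in> carrier G" for s g
      using that conjugacy_class_conj aG unfolding S_def by blast
    ultimately obtain H where H: "S \<subseteq> H" "compactin T H" using compact_normal_hull[OF bal] by metis
    have aH: "a n \<in> H" for n using H(1) conjugacy_class_self[OF aG] unfolding S_def by blast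
    have HG: "H \<subseteq> carrier G" using compactin_subset_topspace[OF H(2)] by (simp add: topspace_eq)
    obtain V where V: "nbhd V" "\<And>x. x \<in> V \<Longrightarrow> inv x \<in> V"
      "\<And>x y z. x \<in> V \<Longrightarrow> y \<in> V \<Longrightarrow> z \<in> V \<Longrightarrow> x \<otimes> y \<otimes> z \<in> U"
      using nbhd_symmetric_cubeE[OF U] by metis
    obtain F where F: "finite F" "F \<subseteq> H" "\<And>y. y \<in> H \<Longrightarrow> \<exists>h\<in>F. inv h \<otimes> y \<in> V"
      using compactin_finite_translates[OF H(2) V(1)] by metis
    obtain h where h: "\<And>n. h n \<in> F" "\<And>n. inv (h n) \<otimes> a n \<in> V" using F(3)[OF aH] by metis
    have "finite (range h)" using h(1) F(1) by (meson finite_subset image_subsetI)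
    then have "\<not> inj h" using finite_imageD infinite_UNIV_nat by blast
    then obtain i j where ij: "i < j" "h i = h j" by (metis injI nat_neq_iff)
    have hG: "h n \<in> carrier G" for n using h(1) F(2) HG by blast
    have "inv (inv (h i) \<otimes> a i) \<otimes> (inv (h i) \<otimes> a j) \<otimes> \<one> \<in> U"
      using V(2,3) h(2)[of i] h(2)[of j] ij(2) nbhd_one[OF V(1)] by simp
    then have "inv (a i) \<otimes> a j \<in> U" using hG aG by (simp add: word_simps)
    then show False using a(2)[OF ij(1)] by blast
  qed
  then obtain F where "finite F" "F \<subseteq> ?Z" "\<forall>z\<in>?Z. \<exists>c\<in>F. inv c \<otimes> z \<in> U" by blast
  then show "\<exists>C. countable C \<and> C \<subseteq> carrier G \<and> (\<forall>b\<in>?Z. \<exists>c\<in>C. inv c \<otimes> b \<in> U)"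
    using ZG by (intro exI[of _ F]) (auto simp: countable_finite)
qed

end

theorem theorem1p20:
  fixes X :: "('a, 'm) monoid_scheme" and T :: "'a topology"
  assumes "topological_group X T"
    and "omega_balanced X T"
    and "MAP_group TYPE('k) X T"
    and "iTG_closed TYPE('a set set) X T"
  shows "compactin T (omega_conjucenter X T)"
proof -
  interpret topological_group X T by fact
  obtain K where "iTG_closed_over_compact X T K"
    using iTG_closed_MAP_over_compact[OF assms(4) assms(3)] .
  then interpret iTG_closed_over_compact X T K .
  let ?Z = "omega_conjucenter X T"
  have nar: "left_narrow ?Z" by (rule left_narrow_omega_conjucenter[OF assms(2)])
  moreover have "left_narrow ((\<lambda>x. inv\<^bsub>X\<^esub> x) ` ?Z)"
    using omega_conjucenter_inv by (intro left_narrow_mono[OF nar]) blast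
  ultimately obtain H where H: "H \<lhd> X" "left_narrow H" "?Z \<subseteq> H" "compactin T H"
    using compact_normal_hull[OF assms(2) _ _ omega_conjucenter_conj] by metis
  have "H \<subseteq> ?Z" by (rule left_narrow_normal_subset_omega_conjucenter[OF H(1,2)])
  then show ?thesis using H(3,4) by (simp add: subset_antisym)
qed

end
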